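(* Let $G$ be a finite group with derived group $G'=[G,G]$ and let $x\in G$. For $g,h\in G'$ define $$\phi^x(g,h)=[hx^{-1},gx^{-1}]=hx^{-1}gh^{-1}xg^{-1},\qquad \psi^x(g,h)=[g,h]\,[hg^{-1},x],$$ which are elements of $G'$. Then the pair $\Phi^x=(\psi^x,\phi^x)$ is an unframed Reidemeister pair for the crossed module $(\mathrm{id}\colon G'\to G')$ with $G'$ acting on itself by conjugation. Moreover, let $K$ be an oriented knot and let $L_K$ be the associated string knot. Then for every $g\in G'$, $$\langle 1_{G'}|I_{\Phi^x}(L_K)|g\rangle=f^K_E(g),$$ that is, the left-hand side is $f^K_E(g)$ times the unique morphism $1_{G'}\to g$ of the category $\mathcal C(\mathrm{id}\colon G'\to G')$, where $f^K_E(g)$ is the coefficient of $g$ in the Eisermann invariant $E(K)$ of $K$ with respect to $(G,x)$.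
   Context: **Notation.** $[a,b]=aba^{-1}b^{-1}$. **Eisermann invariant.** Let $K\subset S^3$ be an oriented knot with complement $C_K=S^3\setminus n(K)$, $n(K)$ an open regular neighbourhood, and let $p\in K$ be a base point; let $m_p,l_p\in\pi_1(C_K)$ be the corresponding meridian (direction given by the right-hand rule) and longitude (parallel to $K$, linking number zero with $K$). Concretely, for a diagram of $K$ cut at $p$, with arcs $a_1,\dots,a_n$ met successively when travelling along $K$ from $p$ to $p$, $\pi_1(C_K)$ has the Wirtinger generators $g_{a_i}$; if $\theta_i=\pm1$ is the sign of the crossing separating $a_i$ from $a_{i+1}$ and $a_{j_i}$ is its over-arc, the relations are $g_{a_{i+1}}=g_{a_{j_i}}^{-\theta_i}g_{a_i}g_{a_{j_i}}^{\theta_i}$, $g_{a_n}=g_{a_1}$, and $m_p=g_{a_1}$, $l_p=\prod_{i=1}^{n-1}g_{a_i}^{-\theta_i}g_{a_{j_i}}^{\theta_i}$ (product in increasing order of $i$). For a finite group $G$ and $x\in G$, the Eisermann invariant is $E(K)=\sum_{f}f(l_p)=\sum_{g\in G'}f^K_E(g)\,g$, the sum being over all group homomorphisms $f\colon\pi_1(C_K)\to G$ with $f(m_p)=x$; so $f^K_E(g)$ is the number of such $f$ with $f(l_p)=g$. **String knots.** A string knot is an oriented tangle whose underlying 1-manifold is an interval, with one end-point at the top and one at the bottom, oriented downwards. Closing gives a bijection between isotopy classes of string knots and of oriented knots; $L_K$ is the string knot whose closure is $K$. **Crossed modules.** A crossed module of groups $\mathcal G=(\partial\colon E\to H,\bullet)$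 is a group homomorphism $\partial\colon E\to H$ with a left action $\bullet$ of $H$ on $E$ by automorphisms such that $\partial(g\bullet e)=g\,\partial(e)\,g^{-1}$ and $\partial(e)\bullet f=efe^{-1}$ for all $g\in H$, $e,f\in E$. **Reidemeister pairs.** A pair $\Phi=(\psi,\phi)$ of functions $\psi,\phi\colon H\times H\to E$ is an *unframed Reidemeister pair* if for all $X,Y,T\in H$: (R1) $\psi(X,X)=1_E$; (R2) $\phi(X,Y)\,\psi(X,Z)=1_E$ where $Z=X^{-1}\partial\phi(X,Y)^{-1}YX$; (R3) $\phi(Y,X)\cdot(Y\bullet\phi(T,Z))\cdot\phi(T,Y)=(X\bullet\phi(T,Y))\cdot\phi(T,X)\cdot(T\bullet\phi(V,W))$ where $Z=Y^{-1}\partial\phi(Y,X)^{-1}XY$, $V=T^{-1}\partial\phi(T,Y)^{-1}YT$, $W=T^{-1}\partial\phi(T,X)^{-1}XT$. **The category $\mathcal C(\mathcal G)$.** Objects are the elements of $H$. Morphisms $U\to V$ are pairs $(U,e)$ with $e\in E$, $\partial(e)=VU^{-1}$ (written $U\xrightarrow{e}V$). The composite of $U\xrightarrow{e}V$ followed by $V\xrightarrow{f}W$ is $U\xrightarrow{fe}W$. The tensor product is $U\otimes V=UV$ on objects, and the tensor product of $U\xrightarrow{e}V$ and $W\xrightarrow{f}X$ is $UW\xrightarrow{(V\bullet f)\,e}VX$. **Diagrams.** The source of a tangle is at the top, the target at the bottom. An oriented tangle diagram is sliced into horizontal strips, each containing vertical strands and at most one elementary piece: the (positive) crossing $X_+$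 (both strands oriented downwards, over-strand from top right to bottom left, under-strand from top left to bottom right), the (negative) crossing $X_-$ (both strands oriented downwards, over-strand from top left to bottom right, under-strand from top right to bottom left), and cups (local minima) and caps (local maxima) with either orientation. Crossings with upward strands are expressed through these pieces. **Reidemeister $\mathcal G$-colourings and state sum.** Let $H$ be finite. For a diagram $D$ of a string knot whose top and bottom end-points are coloured by $a,b\in H$, a Reidemeister $\mathcal G$-colouring $F$ assigns an element of $H$ to each arc and an element of $E$ to each crossing, so that the top arc is coloured $a$, the bottom arc $b$, and: at each $X_+$ with over-arc coloured $X$, lower (bottom right) under-arc coloured $Y$, upper (top left) under-arc coloured $Z$, the crossing is coloured $\psi(X,Y)$ and $Z=\partial\psi(X,Y)^{-1}XYX^{-1}$; at each $X_-$ with over-arc coloured $X$, lower (bottom left) under-arc coloured $Y$, upper (top right) under-arc coloured $Z$, the crossing is coloured $\phi(X,Y)$ and $Z=X^{-1}\partial\phi(X,Y)^{-1}YX$. The evaluation $e(F)$ is the morphism $a\to b$ of $\mathcal C(\mathcal G)$ obtained by tensoring horizontally and composing vertically (from top to bottom) the following morphisms: $X_+\mapsto ZX\xrightarrow{\psi(X,Y)}XY$; $X_-\mapsto XZ\xrightarrow{\phi(X,Y)}YX$; a vertical strand coloured $X$ gives the identity of $X$ if oriented downwards and of $X^{-1}$ if upwards; cups give $XX^{-1}\xrightarrow{1_E}1_H$ or $X^{-1}X\xrightarrow{1_E}1_H$ and caps give $1_H\xrightarrow{1_E}X^{-1}X$ or $1_H\xrightarrow{1_E}XX^{-1}$, according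 to orientation. The state sum is $\langle a|I_\Phi(D)|b\rangle=\sum_Fe(F)\in\mathbb N[\mathrm{Hom}_{\mathcal C(\mathcal G)}(a,b)]$; for an unframed Reidemeister pair it depends only on the string knot. *)

theory Defs
  imports "HOL-Algebra.Generated_Groups" "HOL-Algebra.Bij" "HOL-Library.Poly_Mapping"
begin

section \<open>Groups given by generators and relations\<close>

text \<open>A letter \<open>(s, True)\<close> stands for the generator \<open>s\<close> and \<open>(s, False)\<close> for its inverse;
  a pair \<open>(r, r')\<close> of words stands for the relation \<open>r = r'\<close>.\<close>

type_synonym 's word = "('s \<times> bool) list"

abbreviation words :: "'s set \<Rightarrow> 's word set" where
  "words S \<equiv> lists (S \<times> UNIV)"

inductive_set word_cong :: "'s set \<Rightarrow> ('s word \<times> 's word) set \<Rightarrow> ('s word \<times> 's word) set"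
  for S :: "'s set" and R :: "('s word \<times> 's word) set"
where
  refl: "w \<in> words S \<Longrightarrow> (w, w) \<in> word_cong S R"
| sym: "(v, w) \<in> word_cong S R \<Longrightarrow> (w, v) \<in> word_cong S R"
| trans: "(u, v) \<in> word_cong S R \<Longrightarrow> (v, w) \<in> word_cong S R \<Longrightarrow> (u, w) \<in> word_cong S R"
| cancel: "u \<in> words S \<Longrightarrow> v \<in> words S \<Longrightarrow> s \<in> S \<Longrightarrow>
    (u @ [(s, b), (s, \<not> b)] @ v, u @ v) \<in> word_cong S R"
| relation: "u \<in> words S \<Longrightarrow> v \<in> words S \<Longrightarrow> (r, r') \<in> R \<Longrightarrow>
    (u @ r @ v, u @ r' @ v) \<in> word_cong S R"

definition word_class :: "'s set \<Rightarrow> ('s word \<times> 's word) set \<Rightarrow> 's word \<Rightarrow> 's word set" where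
  "word_class S R w = word_cong S R `` {w}"

definition presented_group :: "'s set \<Rightarrow> ('s word \<times> 's word) set \<Rightarrow> 's word set monoid" where
  "presented_group S R =
    \<lparr>carrier = words S // word_cong S R,
     monoid.mult = (\<lambda>A B. \<Union>u\<in>A. \<Union>v\<in>B. word_class S R (u @ v)),
     one = word_class S R []\<rparr>"

lemma word_cong_words:
  assumes "R \<subseteq> words S \<times> words S" "(v, w) \<in> word_cong S R"
  shows "v \<in> words S \<and> w \<in> words S"
  using assms(2) by (induction rule: word_cong.induct) (use assms(1) in auto)

lemma equiv_word_cong:
  assumes "R \<subseteq> words S \<times> words S"
  shows "equiv (words S) (word_cong S R)"
proof (rule equivI)
  show "word_cong S R \<subseteq> words S \<times> words S"
    using word_cong_words[OF assms] by (intro subrelI) blast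
  show "refl_on (words S) (word_cong S R)"
    by (rule refl_onI) (rule word_cong.refl)
  show "sym_on UNIV (word_cong S R)" by (rule symI) (rule word_cong.sym)
  show "trans_on UNIV (word_cong S R)" by (rule transI) (rule word_cong.trans)
qed

lemma word_cong_context:
  assumes "(v, w) \<in> word_cong S R" "a \<in> words S" "b \<in> words S"
  shows "(a @ v @ b, a @ w @ b) \<in> word_cong S R"
  using assms
proof (induction rule: word_cong.induct)
  case (refl w)
  then show ?case by (intro word_cong.refl) auto
next
  case (sym v w)
  show ?case by (rule word_cong.sym[OF sym.IH[OF sym.prems]])
next
  case (trans u v w)
  show ?case by (rule word_cong.trans[OF trans.IH(1)[OF trans.prems] trans.IH(2)[OF trans.prems]])
next
  case (cancel u v s b')
  then show ?case
    using word_cong.cancel[of "a @ u" S "v @ b" s b' R] by auto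
next
  case (relation u v r r')
  then show ?case
    using word_cong.relation[of "a @ u" S "v @ b" r r' R] by auto
qed

lemma word_cong_append:
  assumes R: "R \<subseteq> words S \<times> words S"
    and "(v, v') \<in> word_cong S R" "(w, w') \<in> word_cong S R"
  shows "(v @ w, v' @ w') \<in> word_cong S R"
proof -
  have "v' \<in> words S" "w \<in> words S" using word_cong_words[OF R] assms by auto
  then have "(v @ w, v' @ w) \<in> word_cong S R" "(v' @ w, v' @ w') \<in> word_cong S R"
    using word_cong_context[OF assms(2), of "[]" w] word_cong_context[OF assms(3), of v' "[]"]
    by auto
  then show ?thesis by (rule word_cong.trans)
qed

lemma presented_mult:
  assumes R: "R \<subseteq> words S \<times> words S" and "v \<in> words S" "w \<in> words S"
  shows "word_class S R v \<otimes>\<^bsub>presented_group S R\<^esub> word_class S R w = word_class S R (v @ w)"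
proof -
  have eq: "word_class S R (v' @ w') = word_class S R (v @ w)"
    if "(v, v') \<in> word_cong S R" "(w, w') \<in> word_cong S R" for v' w'
    unfolding word_class_def
    using equiv_class_eq[OF equiv_word_cong[OF R] word_cong_append[OF R that]] by simp
  have vw: "(v, v) \<in> word_cong S R" "(w, w) \<in> word_cong S R"
    using assms by (auto intro: word_cong.refl)
  have "(\<Union>v'\<in>word_class S R v. \<Union>w'\<in>word_class S R w. word_class S R (v' @ w')) =
      (\<Union>v'\<in>word_class S R v. \<Union>w'\<in>word_class S R w. word_class S R (v @ w))"
    by (intro SUP_cong HOL.refl eq) (simp_all add: word_class_def)
  also have "\<dots> = word_class S R (v @ w)"
    using vw by (auto simp: word_class_def)
  finally show ?thesis by (simp add: presented_group_def)
qed

lemma rev_map_in_words: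
  "w \<in> words S \<Longrightarrow> rev (map (\<lambda>(s, b). (s, \<not> b)) w) \<in> words S"
  by (induction w) auto

lemma word_inverse:
  assumes "w \<in> words S"
  shows "(rev (map (\<lambda>(s, b). (s, \<not> b)) w) @ w, []) \<in> word_cong S R"
  using assms
proof (induction w rule: list.induct)
  case Nil
  then show ?case by (auto intro: word_cong.refl)
next
  case (Cons p w)
  obtain s b where p: "p = (s, b)" by force
  let ?i = "rev (map (\<lambda>(s, b). (s, \<not> b)) w)"
  have w: "w \<in> words S" using Cons.prems by simp
  then have i: "?i \<in> words S" by (rule rev_map_in_words)
  have "(?i @ [(s, \<not> b), (s, \<not> \<not> b)] @ w, ?i @ w) \<in> word_cong S R"
    using Cons.prems p i by (intro word_cong.cancel) auto
  from word_cong.trans[OF this Cons.IH[OF w]] show ?case by (simp add: p)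
qed

lemma group_presented_group:
  assumes R: "R \<subseteq> words S \<times> words S"
  shows "group (presented_group S R)" (is "group ?P")
proof -
  have cl: "carrier ?P = word_class S R ` words S"
    by (simp add: presented_group_def quotient_def word_class_def UNION_singleton_eq_range)
  have one: "\<one>\<^bsub>?P\<^esub> = word_class S R []" by (simp add: presented_group_def)
  note mult = presented_mult[OF R]
  have inv: "\<exists>y\<in>carrier ?P. y \<otimes>\<^bsub>?P\<^esub> x = \<one>\<^bsub>?P\<^esub>" if x: "x \<in> carrier ?P" for x
  proof -
    obtain w where w: "w \<in> words S" "x = word_class S R w" using x unfolding cl by blast
    let ?i = "rev (map (\<lambda>(s, b). (s, \<not> b)) w)"
    have i: "?i \<in> words S" using w(1) by (rule rev_map_in_words)
    have "word_class S R (?i @ w) = word_class S R []"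
      unfolding word_class_def
      by (rule equiv_class_eq[OF equiv_word_cong[OF R] word_inverse[OF w(1)]])
    then have "word_class S R ?i \<otimes>\<^bsub>?P\<^esub> x = \<one>\<^bsub>?P\<^esub>"
      unfolding w(2) mult[OF i w(1)] one .
    moreover have "word_class S R ?i \<in> carrier ?P" unfolding cl using i by (rule imageI)
    ultimately show ?thesis by blast
  qed
  show ?thesis
  proof (rule groupI)
    fix x y assume "x \<in> carrier ?P" "y \<in> carrier ?P"
    then obtain v w where "v \<in> words S" "x = word_class S R v" "w \<in> words S"
      "y = word_class S R w" unfolding cl by blast
    then show "x \<otimes>\<^bsub>?P\<^esub> y \<in> carrier ?P" unfolding cl by (simp add: mult)
  next
    fix x y z assume "x \<in> carrier ?P" "y \<in> carrier ?P" "z \<in> carrier ?P"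
    then obtain u v w where "u \<in> words S" "x = word_class S R u" "v \<in> words S"
      "y = word_class S R v" "w \<in> words S" "z = word_class S R w" unfolding cl by blast
    then show "x \<otimes>\<^bsub>?P\<^esub> y \<otimes>\<^bsub>?P\<^esub> z = x \<otimes>\<^bsub>?P\<^esub> (y \<otimes>\<^bsub>?P\<^esub> z)"
      by (simp add: mult)
  next
    fix x assume "x \<in> carrier ?P"
    then obtain w where "w \<in> words S" "x = word_class S R w" unfolding cl by blast
    then show "\<one>\<^bsub>?P\<^esub> \<otimes>\<^bsub>?P\<^esub> x = x" using mult[of "[]" w] by (simp add: one)
  next
    show "\<one>\<^bsub>?P\<^esub> \<in> carrier ?P" unfolding cl one by (intro imageI) simp
  qed (rule inv)
qed


section \<open>Crossed modules and Reidemeister pairs\<close>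

record ('h, 'e) xmod =
  Hgrp :: "'h monoid"
  Egrp :: "'e monoid"
  bd :: "'e \<Rightarrow> 'h"
  act :: "'h \<Rightarrow> 'e \<Rightarrow> 'e"

text \<open>Elements of \<^const>\<open>AutoGroup\<close> are extensional functions, so an action is required to be
  extensional in its second argument.\<close>

locale crossed_module =
  fixes M :: "('h, 'e) xmod"
  assumes group_H: "group (Hgrp M)"
    and group_E: "group (Egrp M)"
    and bd_hom: "bd M \<in> hom (Egrp M) (Hgrp M)"
    and act_hom: "act M \<in> hom (Hgrp M) (AutoGroup (Egrp M))"
    and bd_act: "\<And>g e. g \<in> carrier (Hgrp M) \<Longrightarrow> e \<in> carrier (Egrp M) \<Longrightarrow>
      bd M (act M g e) = g \<otimes>\<^bsub>Hgrp M\<^esub> bd M e \<otimes>\<^bsub>Hgrp M\<^esub> inv\<^bsub>Hgrp M\<^esub> g"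
    and peiffer: "\<And>e f. e \<in> carrier (Egrp M) \<Longrightarrow> f \<in> carrier (Egrp M) \<Longrightarrow>
      act M (bd M e) f = e \<otimes>\<^bsub>Egrp M\<^esub> f \<otimes>\<^bsub>Egrp M\<^esub> inv\<^bsub>Egrp M\<^esub> e"

text \<open>The crossed module \<open>(id : N \<rightarrow> N)\<close>, with \<open>N\<close> acting on itself by conjugation.\<close>

definition id_xmod :: "'a monoid \<Rightarrow> ('a, 'a) xmod" where
  "id_xmod N = \<lparr>Hgrp = N, Egrp = N, bd = id,
     act = (\<lambda>g. \<lambda>e\<in>carrier N. g \<otimes>\<^bsub>N\<^esub> e \<otimes>\<^bsub>N\<^esub> inv\<^bsub>N\<^esub> g)\<rparr>"

text \<open>\<open>under_neg\<close> (resp. \<open>under_pos\<close>) is the colour of the upper under-arc at a negative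
  (resp. positive) crossing with over-arc coloured \<open>x\<close>, lower under-arc coloured \<open>y\<close> and
  crossing coloured \<open>e\<close>.\<close>

definition under_neg :: "('h, 'e) xmod \<Rightarrow> 'e \<Rightarrow> 'h \<Rightarrow> 'h \<Rightarrow> 'h" where
  "under_neg M e x y =
     inv\<^bsub>Hgrp M\<^esub> x \<otimes>\<^bsub>Hgrp M\<^esub> inv\<^bsub>Hgrp M\<^esub> (bd M e) \<otimes>\<^bsub>Hgrp M\<^esub> y \<otimes>\<^bsub>Hgrp M\<^esub> x"

definition under_pos :: "('h, 'e) xmod \<Rightarrow> 'e \<Rightarrow> 'h \<Rightarrow> 'h \<Rightarrow> 'h" where
  "under_pos M e x y =
     inv\<^bsub>Hgrp M\<^esub> (bd M e) \<otimes>\<^bsub>Hgrp M\<^esub> x \<otimes>\<^bsub>Hgrp M\<^esub> y \<otimes>\<^bsub>Hgrp M\<^esub> inv\<^bsub>Hgrp M\<^esub> x"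

definition unframed_Reidemeister_pair ::
  "('h, 'e) xmod \<Rightarrow> ('h \<Rightarrow> 'h \<Rightarrow> 'e) \<Rightarrow> ('h \<Rightarrow> 'h \<Rightarrow> 'e) \<Rightarrow> bool" where
  "unframed_Reidemeister_pair M \<psi> \<phi> \<longleftrightarrow>
    \<psi> \<in> carrier (Hgrp M) \<rightarrow> carrier (Hgrp M) \<rightarrow> carrier (Egrp M) \<and>
    \<phi> \<in> carrier (Hgrp M) \<rightarrow> carrier (Hgrp M) \<rightarrow> carrier (Egrp M) \<and>
    (\<forall>x\<in>carrier (Hgrp M). \<psi> x x = \<one>\<^bsub>Egrp M\<^esub>) \<and>
    (\<forall>x\<in>carrier (Hgrp M). \<forall>y\<in>carrier (Hgrp M).
       let z = under_neg M (\<phi> x y) x y in \<phi> x y \<otimes>\<^bsub>Egrp M\<^esub> \<psi> x z = \<one>\<^bsub>Egrp M\<^esub>) \<and>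
    (\<forall>x\<in>carrier (Hgrp M). \<forall>y\<in>carrier (Hgrp M). \<forall>t\<in>carrier (Hgrp M).
       let z = under_neg M (\<phi> y x) y x;
           v = under_neg M (\<phi> t y) t y;
           w = under_neg M (\<phi> t x) t x
       in \<phi> y x \<otimes>\<^bsub>Egrp M\<^esub> act M y (\<phi> t z) \<otimes>\<^bsub>Egrp M\<^esub> \<phi> t y =
          act M x (\<phi> t y) \<otimes>\<^bsub>Egrp M\<^esub> \<phi> t x \<otimes>\<^bsub>Egrp M\<^esub> act M t (\<phi> v w))"


section \<open>The monoidal category of a crossed module\<close>

text \<open>A morphism is a pair \<open>(U, e)\<close>; its target is \<open>\<partial>(e)U\<close>.\<close>

type_synonym ('h, 'e) mor = "'h \<times> 'e"

definition Hom :: "('h, 'e) xmod \<Rightarrow> 'h \<Rightarrow> 'h \<Rightarrow> ('h, 'e) mor set" where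
  "Hom M U V = {(U, e) | e. e \<in> carrier (Egrp M) \<and> bd M e = V \<otimes>\<^bsub>Hgrp M\<^esub> inv\<^bsub>Hgrp M\<^esub> U}"

definition tgt :: "('h, 'e) xmod \<Rightarrow> ('h, 'e) mor \<Rightarrow> 'h" where
  "tgt M m = bd M (snd m) \<otimes>\<^bsub>Hgrp M\<^esub> fst m"

definition id_mor :: "('h, 'e) xmod \<Rightarrow> 'h \<Rightarrow> ('h, 'e) mor" where
  "id_mor M U = (U, \<one>\<^bsub>Egrp M\<^esub>)"

text \<open>\<open>seq_mor M m m'\<close> is \<open>m\<close> followed by \<open>m'\<close>.\<close>

definition seq_mor :: "('h, 'e) xmod \<Rightarrow> ('h, 'e) mor \<Rightarrow> ('h, 'e) mor \<Rightarrow> ('h, 'e) mor" where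
  "seq_mor M m m' = (fst m, snd m' \<otimes>\<^bsub>Egrp M\<^esub> snd m)"

definition tensor_mor :: "('h, 'e) xmod \<Rightarrow> ('h, 'e) mor \<Rightarrow> ('h, 'e) mor \<Rightarrow> ('h, 'e) mor" where
  "tensor_mor M m m' =
     (fst m \<otimes>\<^bsub>Hgrp M\<^esub> fst m', act M (tgt M m) (snd m') \<otimes>\<^bsub>Egrp M\<^esub> snd m)"

definition tensor_list :: "('h, 'e) xmod \<Rightarrow> ('h, 'e) mor list \<Rightarrow> ('h, 'e) mor" where
  "tensor_list M ms = foldr (tensor_mor M) ms (id_mor M \<one>\<^bsub>Hgrp M\<^esub>)"


section \<open>Diagrams of string knots\<close>

datatype orient = Dn | Up

fun flip :: "orient \<Rightarrow> orient" where
  "flip Dn = Up"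
| "flip Up = Dn"

text \<open>The argument of a cup or cap is the orientation of its left end; \<open>Cup\<close> is a local
  minimum and \<open>Cap\<close> a local maximum.\<close>

datatype piece = XPos | XNeg | Cup orient | Cap orient

fun piece_top :: "piece option \<Rightarrow> orient list" where
  "piece_top (Some XPos) = [Dn, Dn]"
| "piece_top (Some XNeg) = [Dn, Dn]"
| "piece_top (Some (Cup a)) = [a, flip a]"
| "piece_top (Some (Cap a)) = []"
| "piece_top None = []"

fun piece_bot :: "piece option \<Rightarrow> orient list" where
  "piece_bot (Some XPos) = [Dn, Dn]"
| "piece_bot (Some XNeg) = [Dn, Dn]"
| "piece_bot (Some (Cup a)) = []"
| "piece_bot (Some (Cap a)) = [a, flip a]"
| "piece_bot None = []"

text \<open>A strip: vertical strands, at most one elementary piece, vertical strands.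
  A diagram is the list of its strips from top to bottom.\<close>

datatype strip = Strip (lefts: "orient list") (mid: "piece option") (rights: "orient list")

type_synonym diagram = "strip list"

definition strip_top :: "strip \<Rightarrow> orient list" where
  "strip_top s = lefts s @ piece_top (mid s) @ rights s"

definition strip_bot :: "strip \<Rightarrow> orient list" where
  "strip_bot s = lefts s @ piece_bot (mid s) @ rights s"

fun tangle_diagram :: "orient list \<Rightarrow> diagram \<Rightarrow> orient list \<Rightarrow> bool" where
  "tangle_diagram us [] vs \<longleftrightarrow> us = vs"
| "tangle_diagram us (s # D) vs \<longleftrightarrow> us = strip_top s \<and> tangle_diagram (strip_bot s) D vs"

text \<open>The point \<open>(i, k)\<close> is the \<open>k\<close>-th strand, counted from the left, on the horizontal line
  between strips \<open>i - 1\<close> and \<open>i\<close>. The top end-point is \<open>(0, 0)\<close>, the bottom one is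
  \<open>(length D, 0)\<close>.\<close>

type_synonym point = "nat \<times> nat"

definition level :: "diagram \<Rightarrow> nat \<Rightarrow> orient list" where
  "level D i = (if i = 0 then [Dn] else strip_bot (D ! (i - 1)))"

definition points :: "diagram \<Rightarrow> point set" where
  "points D = {(i, k). i \<le> length D \<and> k < length (level D i)}"

text \<open>Pairs of points joined inside strip \<open>i\<close> by a strand that does not pass under a crossing.\<close>

definition joins :: "nat \<Rightarrow> strip \<Rightarrow> (point \<times> point) set" where
  "joins i s = (let l = length (lefts s) in
     {((i, k), (Suc i, k)) | k. k < l} \<union>
     {((i, l + length (piece_top (mid s)) + k), (Suc i, l + length (piece_bot (mid s)) + k)) | k.
        k < length (rights s)} \<union>
     (case mid s of
        None \<Rightarrow> {}
      | Some XPos \<Rightarrow> {((i, l + 1), (Suc i, l))}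
      | Some XNeg \<Rightarrow> {((i, l), (Suc i, l + 1))}
      | Some (Cup _) \<Rightarrow> {((i, l), (i, l + 1))}
      | Some (Cap _) \<Rightarrow> {((Suc i, l), (Suc i, l + 1))}))"

text \<open>Crossings are identified with the indices of the strips containing them.\<close>

definition crossings :: "diagram \<Rightarrow> nat set" where
  "crossings D = {c. c < length D \<and> (mid (D ! c) = Some XPos \<or> mid (D ! c) = Some XNeg)}"

definition positive :: "diagram \<Rightarrow> nat \<Rightarrow> bool" where
  "positive D c \<longleftrightarrow> mid (D ! c) = Some XPos"

definition under_top :: "diagram \<Rightarrow> nat \<Rightarrow> point" where
  "under_top D c = (let l = length (lefts (D ! c)) in if positive D c then (c, l) else (c, l + 1))"

definition under_bot :: "diagram \<Rightarrow> nat \<Rightarrow> point" where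
  "under_bot D c =
     (let l = length (lefts (D ! c)) in if positive D c then (Suc c, l + 1) else (Suc c, l))"

definition over_top :: "diagram \<Rightarrow> nat \<Rightarrow> point" where
  "over_top D c = (let l = length (lefts (D ! c)) in if positive D c then (c, l + 1) else (c, l))"

definition arc_joins :: "diagram \<Rightarrow> (point \<times> point) set" where
  "arc_joins D = (\<Union>i<length D. joins i (D ! i))"

definition strand_joins :: "diagram \<Rightarrow> (point \<times> point) set" where
  "strand_joins D = arc_joins D \<union> (\<lambda>c. (under_top D c, under_bot D c)) ` crossings D"

text \<open>The underlying 1-manifold has exactly two end-points, so it is an interval iff it is
  connected.\<close>

definition string_knot_diagram :: "diagram \<Rightarrow> bool" where
  "string_knot_diagram D \<longleftrightarrow> tangle_diagram [Dn] D [Dn] \<and>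
     points D \<times> points D \<subseteq> (strand_joins D \<union> (strand_joins D)\<inverse>)\<^sup>*"

type_synonym arc = "point set"

definition arc_rel :: "diagram \<Rightarrow> (point \<times> point) set" where
  "arc_rel D = (arc_joins D \<union> (arc_joins D)\<inverse>)\<^sup>*"

definition arc_of :: "diagram \<Rightarrow> point \<Rightarrow> arc" where
  "arc_of D p = arc_rel D `` {p}"

definition arcs :: "diagram \<Rightarrow> arc set" where
  "arcs D = points D // arc_rel D"

definition top_arc :: "diagram \<Rightarrow> arc" where
  "top_arc D = arc_of D (0, 0)"

definition bot_arc :: "diagram \<Rightarrow> arc" where
  "bot_arc D = arc_of D (length D, 0)"

definition over_arc :: "diagram \<Rightarrow> nat \<Rightarrow> arc" where
  "over_arc D c = arc_of D (over_top D c)"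

definition under_in :: "diagram \<Rightarrow> nat \<Rightarrow> arc" where
  "under_in D c = arc_of D (under_top D c)"

definition under_out :: "diagram \<Rightarrow> nat \<Rightarrow> arc" where
  "under_out D c = arc_of D (under_bot D c)"


section \<open>Knot group, meridian, longitude and Eisermann invariant\<close>

text \<open>In this section a string knot diagram \<open>D\<close> is regarded as the diagram of the oriented knot
  \<open>K\<close> obtained by closing it, cut at a base point \<open>p\<close> on the closing strand. Both strands of
  every crossing run downwards, so \<open>K\<close> runs through a crossing \<open>c\<close> from \<open>under_in D c\<close> to
  \<open>under_out D c\<close>. With indices starting at 0, \<open>kth_arc D k\<close> is the arc \<open>a\<^sub>k\<^sub>+\<^sub>1\<close> met when
  travelling along \<open>K\<close> from \<open>p\<close>, and \<open>kth_crossing D k\<close> is the crossing separating it from the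
  next arc.\<close>

definition end_crossing :: "diagram \<Rightarrow> arc \<Rightarrow> nat" where
  "end_crossing D a = (THE c. c \<in> crossings D \<and> under_in D c = a)"

primrec kth_arc :: "diagram \<Rightarrow> nat \<Rightarrow> arc" where
  "kth_arc D 0 = top_arc D"
| "kth_arc D (Suc k) = under_out D (end_crossing D (kth_arc D k))"

definition kth_crossing :: "diagram \<Rightarrow> nat \<Rightarrow> nat" where
  "kth_crossing D k = end_crossing D (kth_arc D k)"

definition num_arcs :: "diagram \<Rightarrow> nat" where
  "num_arcs D = card (arcs D)"

text \<open>For a crossing with sign \<open>\<theta>\<close>, the letter \<open>(a, positive D c)\<close> is \<open>g\<^sub>a\<close> to the power \<open>\<theta>\<close> and
  \<open>(a, \<not> positive D c)\<close> is \<open>g\<^sub>a\<close> to the power \<open>-\<theta>\<close>.\<close>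

definition wirtinger_relations :: "diagram \<Rightarrow> (arc word \<times> arc word) set" where
  "wirtinger_relations D =
     {([(kth_arc D (Suc k), True)],
       [(over_arc D c, \<not> positive D c), (kth_arc D k, True), (over_arc D c, positive D c)])
      | k c. k < num_arcs D - 1 \<and> c = kth_crossing D k} \<union>
     {([(kth_arc D (num_arcs D - 1), True)], [(kth_arc D 0, True)])}"

definition knot_group :: "diagram \<Rightarrow> arc word set monoid" where
  "knot_group D = presented_group (arcs D) (wirtinger_relations D)"

definition meridian :: "diagram \<Rightarrow> arc word set" where
  "meridian D = word_class (arcs D) (wirtinger_relations D) [(kth_arc D 0, True)]"

definition longitude :: "diagram \<Rightarrow> arc word set" where
  "longitude D = word_class (arcs D) (wirtinger_relations D)
     (concat (map (\<lambda>k. let c = kth_crossing D k in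
        [(kth_arc D k, \<not> positive D c), (over_arc D c, positive D c)]) [0..<num_arcs D - 1]))"

text \<open>Formal sums with natural number coefficients are finitely supported functions into
  \<^typ>\<open>nat\<close>. Homomorphisms are taken extensional, so that each is counted once.\<close>

definition eisermann_invariant :: "('a, 'm) monoid_scheme \<Rightarrow> 'a \<Rightarrow> diagram \<Rightarrow> ('a \<Rightarrow>\<^sub>0 nat)" where
  "eisermann_invariant G x D =
     (\<Sum>f | f \<in> hom (knot_group D) G \<inter> extensional (carrier (knot_group D)) \<and> f (meridian D) = x.
        Poly_Mapping.single (f (longitude D)) 1)"

definition eisermann_coeff :: "('a, 'm) monoid_scheme \<Rightarrow> 'a \<Rightarrow> diagram \<Rightarrow> 'a \<Rightarrow> nat" where
  "eisermann_coeff G x D g = Poly_Mapping.lookup (eisermann_invariant G x D) g"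


section \<open>Reidemeister colourings and the state sum\<close>

text \<open>A colouring is a pair of a colouring of the arcs and a colouring of the crossings.\<close>

type_synonym ('h, 'e) colouring = "(arc \<Rightarrow> 'h) \<times> (nat \<Rightarrow> 'e)"

definition colourings ::
  "('h, 'e) xmod \<Rightarrow> ('h \<Rightarrow> 'h \<Rightarrow> 'e) \<Rightarrow> ('h \<Rightarrow> 'h \<Rightarrow> 'e) \<Rightarrow> diagram \<Rightarrow> 'h \<Rightarrow> 'h \<Rightarrow>
   ('h, 'e) colouring set" where
  "colourings M \<psi> \<phi> D a b =
    {(F, C). F \<in> arcs D \<rightarrow>\<^sub>E carrier (Hgrp M) \<and> C \<in> crossings D \<rightarrow>\<^sub>E carrier (Egrp M) \<and>
       F (top_arc D) = a \<and> F (bot_arc D) = b \<and>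
       (\<forall>c\<in>crossings D. let x = F (over_arc D c); y = F (under_out D c); z = F (under_in D c) in
          if positive D c
          then C c = \<psi> x y \<and> z = under_pos M (\<psi> x y) x y
          else C c = \<phi> x y \<and> z = under_neg M (\<phi> x y) x y)}"

fun signed :: "('h, 'e) xmod \<Rightarrow> orient \<Rightarrow> 'h \<Rightarrow> 'h" where
  "signed M Dn x = x"
| "signed M Up x = inv\<^bsub>Hgrp M\<^esub> x"

text \<open>The identities of the vertical strands with orientations \<open>os\<close> starting from the points
  \<open>(i, k)\<close>, \<open>(i, k + 1)\<close>, \<dots>\<close>

definition strand_mors ::
  "('h, 'e) xmod \<Rightarrow> diagram \<Rightarrow> ('h, 'e) colouring \<Rightarrow> nat \<Rightarrow> nat \<Rightarrow> orient list \<Rightarrow> ('h, 'e) mor list"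
where
  "strand_mors M D FC i k os =
     map (\<lambda>j. id_mor M (signed M (os ! j) (fst FC (arc_of D (i, k + j))))) [0..<length os]"

definition piece_mors ::
  "('h, 'e) xmod \<Rightarrow> diagram \<Rightarrow> ('h, 'e) colouring \<Rightarrow> nat \<Rightarrow> ('h, 'e) mor list" where
  "piece_mors M D FC i = (let l = length (lefts (D ! i)) in
     case mid (D ! i) of
       None \<Rightarrow> []
     | Some XPos \<Rightarrow>
         [(fst FC (under_in D i) \<otimes>\<^bsub>Hgrp M\<^esub> fst FC (over_arc D i), snd FC i)]
     | Some XNeg \<Rightarrow>
         [(fst FC (over_arc D i) \<otimes>\<^bsub>Hgrp M\<^esub> fst FC (under_in D i), snd FC i)]
     | Some (Cup a) \<Rightarrow> (let x = fst FC (arc_of D (i, l)) in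
         [(signed M a x \<otimes>\<^bsub>Hgrp M\<^esub> signed M (flip a) x, \<one>\<^bsub>Egrp M\<^esub>)])
     | Some (Cap a) \<Rightarrow> [(\<one>\<^bsub>Hgrp M\<^esub>, \<one>\<^bsub>Egrp M\<^esub>)])"

definition strip_mor ::
  "('h, 'e) xmod \<Rightarrow> diagram \<Rightarrow> ('h, 'e) colouring \<Rightarrow> nat \<Rightarrow> ('h, 'e) mor" where
  "strip_mor M D FC i = (let s = D ! i; l = length (lefts s) in
     tensor_list M
       (strand_mors M D FC i 0 (lefts s) @
        piece_mors M D FC i @
        strand_mors M D FC i (l + length (piece_top (mid s))) (rights s)))"

definition evaluation ::
  "('h, 'e) xmod \<Rightarrow> diagram \<Rightarrow> ('h, 'e) colouring \<Rightarrow> ('h, 'e) mor" where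
  "evaluation M D FC =
     foldl (seq_mor M) (id_mor M (fst FC (top_arc D))) (map (strip_mor M D FC) [0..<length D])"

definition state_sum ::
  "('h, 'e) xmod \<Rightarrow> ('h \<Rightarrow> 'h \<Rightarrow> 'e) \<Rightarrow> ('h \<Rightarrow> 'h \<Rightarrow> 'e) \<Rightarrow> diagram \<Rightarrow> 'h \<Rightarrow> 'h \<Rightarrow>
   (('h, 'e) mor \<Rightarrow>\<^sub>0 nat)" where
  "state_sum M \<psi> \<phi> D a b =
     (\<Sum>FC\<in>colourings M \<psi> \<phi> D a b. Poly_Mapping.single (evaluation M D FC) 1)"


section \<open>The Reidemeister pair of \<open>(G, x)\<close>\<close>

definition commutator :: "('a, 'm) monoid_scheme \<Rightarrow> 'a \<Rightarrow> 'a \<Rightarrow> 'a" where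
  "commutator G a b = a \<otimes>\<^bsub>G\<^esub> b \<otimes>\<^bsub>G\<^esub> inv\<^bsub>G\<^esub> a \<otimes>\<^bsub>G\<^esub> inv\<^bsub>G\<^esub> b"

definition derived_group :: "('a, 'm) monoid_scheme \<Rightarrow> ('a, 'm) monoid_scheme" where
  "derived_group G = G\<lparr>carrier := derived G (carrier G)\<rparr>"

definition eis_phi :: "('a, 'm) monoid_scheme \<Rightarrow> 'a \<Rightarrow> 'a \<Rightarrow> 'a \<Rightarrow> 'a" where
  "eis_phi G x g h = commutator G (h \<otimes>\<^bsub>G\<^esub> inv\<^bsub>G\<^esub> x) (g \<otimes>\<^bsub>G\<^esub> inv\<^bsub>G\<^esub> x)"

definition eis_psi :: "('a, 'm) monoid_scheme \<Rightarrow> 'a \<Rightarrow> 'a \<Rightarrow> 'a \<Rightarrow> 'a" where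
  "eis_psi G x g h = commutator G g h \<otimes>\<^bsub>G\<^esub> commutator G (h \<otimes>\<^bsub>G\<^esub> inv\<^bsub>G\<^esub> g) x"

end

theory Submission
  imports Defs
begin

text \<open>For a homomorphism \<open>f\<close> from the knot group with \<open>f(m\<^sub>p) = x\<close>, let \<open>F(a\<^sub>k)\<close> be the image under
  \<open>f\<close> of the \<open>k\<close>-th partial product of the longitude. Then \<open>f(g\<^sub>a) = F(a)\<inverse> x F(a)\<close> for every arc
  \<open>a\<close>, and the step from \<open>F(a\<^sub>k)\<close> to \<open>F(a\<^sub>k\<^sub>+\<^sub>1)\<close> is exactly the colouring condition of \<open>\<Phi>\<^sup>x\<close> at the
  \<open>k\<close>-th crossing; the factors of the longitude are quotients of conjugates of \<open>x\<close>, so \<open>F\<close>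
  takes values in \<open>G'\<close>. Conversely a colouring determines \<open>f\<close> by this formula. The remaining
  Wirtinger relation \<open>g\<^sub>a\<^sub>n = g\<^sub>a\<^sub>1\<close> is a consequence of the others because the signed product of the
  generators along a horizontal line does not depend on its height. The same telescoping over the
  strips shows that the evaluation of a colouring is a morphism \<open>1 \<rightarrow> g\<close>, and there is only one.

  That the \<open>a\<^sub>k\<close> exhaust the arcs uses that the oriented diagram is the graph of a partial injection
  on its points, which by connectedness is a single path from top to bottom.\<close>


section \<open>The Reidemeister pair\<close>

context group
begin

lemma inv_cancel_left:
  assumes "a \<in> carrier G" "b \<in> carrier G"
  shows "inv a \<otimes> (a \<otimes> b) = b" "a \<otimes> (inv a \<otimes> b) = b"
  using assms by (simp_all add: m_assoc[symmetric])

text \<open>With the unit and inverse laws these rules bring a product of letters and inverse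
  letters to a reduced, right-nested word; the cancellation rules also act inside longer words.
  Identities valid in a free group are thus closed by simplification.\<close>

lemmas word_simps = m_assoc inv_mult_group inv_cancel_left

lemma commutator_in_derived:
  assumes "a \<in> carrier G" "b \<in> carrier G"
  shows "commutator G a b \<in> derived G (carrier G)"
  unfolding derived_def commutator_def by (rule generate.incl) (use assms in blast)

lemma derived_subgroup: "subgroup (derived G (carrier G)) G"
  by (rule derived_is_subgroup) simp

lemma derived_in_carrier: "a \<in> derived G (carrier G) \<Longrightarrow> a \<in> carrier G"
  using subgroup.subset[OF derived_subgroup] by blast

lemma group_derived_group: "group (derived_group G)"
  unfolding derived_group_def by (rule subgroup.subgroup_is_group[OF derived_subgroup]) (rule group_axioms)

lemma inv_derived_group:
  "a \<in> derived G (carrier G) \<Longrightarrow> inv\<^bsub>derived_group G\<^esub> a = inv a"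
  unfolding derived_group_def by (rule m_inv_consistent[OF derived_subgroup])

lemma derived_group_simps:
  "carrier (derived_group G) = derived G (carrier G)"
  "mult (derived_group G) = mult G" "one (derived_group G) = one G"
  by (simp_all add: derived_group_def)

end

lemma crossed_module_id_xmod:
  fixes G :: "'a monoid" (structure)
  assumes "group G"
  shows "crossed_module (id_xmod G)"
proof -
  interpret group G by (rule assms)
  have auto: "(\<lambda>e\<in>carrier G. g \<otimes> e \<otimes> inv g) \<in> auto G" if g: "g \<in> carrier G" for g
  proof -
    have "bij_betw (\<lambda>e\<in>carrier G. g \<otimes> e \<otimes> inv g) (carrier G) (carrier G)"
      by (rule bij_betwI[where g = "\<lambda>e. inv g \<otimes> e \<otimes> g"]) (use g in \<open>auto simp: word_simps\<close>)
    then show ?thesis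
      using g by (auto simp: auto_def hom_def Bij_def word_simps)
  qed
  show ?thesis
  proof (rule crossed_module.intro)
    show "bd (id_xmod G) \<in> hom (Egrp (id_xmod G)) (Hgrp (id_xmod G))"
      by (simp add: id_xmod_def hom_def)
    show "act (id_xmod G) \<in> hom (Hgrp (id_xmod G)) (AutoGroup (Egrp (id_xmod G)))"
    proof (rule homI)
      fix g assume "g \<in> carrier (Hgrp (id_xmod G))"
      then show "act (id_xmod G) g \<in> carrier (AutoGroup (Egrp (id_xmod G)))"
        using auto by (simp add: id_xmod_def AutoGroup_def)
    next
      fix g h assume "g \<in> carrier (Hgrp (id_xmod G))" "h \<in> carrier (Hgrp (id_xmod G))"
      then show "act (id_xmod G) (g \<otimes>\<^bsub>Hgrp (id_xmod G)\<^esub> h) =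
        act (id_xmod G) g \<otimes>\<^bsub>AutoGroup (Egrp (id_xmod G))\<^esub> act (id_xmod G) h"
        using auto by (auto simp: id_xmod_def AutoGroup_def BijGroup_def auto_def compose_def
            word_simps fun_eq_iff restrict_def)
    qed
  qed (simp_all add: id_xmod_def assms)
qed

section \<open>The pair of \<open>(G, x)\<close>: closed forms of the colour rules, and the
  axioms\<close>

locale eisermann = group G for G :: "'a monoid" (structure) +
  fixes x assumes x: "x \<in> carrier G"
begin

lemma eis_phi_eq:
  assumes "g \<in> carrier G" "h \<in> carrier G"
  shows "eis_phi G x g h = h \<otimes> inv x \<otimes> g \<otimes> inv h \<otimes> x \<otimes> inv g"
  using assms x by (simp add: eis_phi_def commutator_def word_simps)

lemma eis_psi_eq:
  assumes "g \<in> carrier G" "h \<in> carrier G"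
  shows "eis_psi G x g h = g \<otimes> h \<otimes> inv g \<otimes> inv g \<otimes> x \<otimes> g \<otimes> inv h \<otimes> inv x"
  using assms x by (simp add: eis_psi_def commutator_def word_simps)

lemma eis_phi_in_derived:
  "g \<in> derived G (carrier G) \<Longrightarrow> h \<in> derived G (carrier G) \<Longrightarrow>
    eis_phi G x g h \<in> derived G (carrier G)"
  unfolding eis_phi_def using x by (intro commutator_in_derived) (auto dest: derived_in_carrier)

lemma eis_psi_in_derived:
  "g \<in> derived G (carrier G) \<Longrightarrow> h \<in> derived G (carrier G) \<Longrightarrow>
    eis_psi G x g h \<in> derived G (carrier G)"
  unfolding eis_psi_def using x
  by (intro subgroup.m_closed[OF derived_subgroup] commutator_in_derived)
    (auto dest: derived_in_carrier)

text \<open>The inverse of the crossing colour begins with \<open>g\<close> and ends with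
  \<open>inv h\<close>, which cancel against its neighbours. What is left is the rule by which
  partial longitudes change under a negative crossing, read against the orientation.\<close>

lemma under_neg_eis_phi:
  assumes "g \<in> derived G (carrier G)" "h \<in> derived G (carrier G)"
  shows "under_neg (id_xmod (derived_group G)) (eis_phi G x g h) g h =
    inv x \<otimes> h \<otimes> inv g \<otimes> x \<otimes> g"
  using assms[THEN derived_in_carrier] x
    inv_derived_group[OF eis_phi_in_derived[OF assms]] assms[THEN inv_derived_group]
  by (simp add: under_neg_def id_xmod_def derived_group_simps eis_phi_eq word_simps)

lemma under_pos_eis_psi:
  assumes "g \<in> derived G (carrier G)" "h \<in> derived G (carrier G)"
  shows "under_pos (id_xmod (derived_group G)) (eis_psi G x g h) g h =
    x \<otimes> h \<otimes> inv g \<otimes> inv x \<otimes> g"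
  using assms[THEN derived_in_carrier] x
    inv_derived_group[OF eis_psi_in_derived[OF assms]] assms[THEN inv_derived_group]
  by (simp add: under_pos_def id_xmod_def derived_group_simps eis_psi_eq word_simps)

text \<open>The letter \<open>x\<close> need not lie in the derived group, so membership is read off
  from \<open>under_neg\<close>, all of whose factors do.\<close>

lemma under_neg_in_derived:
  assumes "g \<in> derived G (carrier G)" "h \<in> derived G (carrier G)"
  shows "inv x \<otimes> h \<otimes> inv g \<otimes> x \<otimes> g \<in> derived G (carrier G)"
proof -
  interpret N: group "derived_group G" by (rule group_derived_group)
  have "under_neg (id_xmod (derived_group G)) (eis_phi G x g h) g h \<in> carrier (derived_group G)"
    using assms[folded derived_group_simps(1)] eis_phi_in_derived[OF assms, folded derived_group_simps(1)]
    by (simp add: under_neg_def id_xmod_def)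
  then show ?thesis using under_neg_eis_phi[OF assms] by (simp add: derived_group_simps)
qed

lemma unframed_eis:
  "unframed_Reidemeister_pair (id_xmod (derived_group G)) (eis_psi G x) (eis_phi G x)"
proof -
  let ?N = "derived G (carrier G)" and ?M = "id_xmod (derived_group G)"
  have act: "act ?M g h = g \<otimes> h \<otimes> inv g" if "g \<in> ?N" "h \<in> ?N" for g h
    using that by (simp add: id_xmod_def derived_group_simps inv_derived_group)
  have R1: "eis_psi G x g g = \<one>" if "g \<in> ?N" for g
    using derived_in_carrier[OF that] x by (simp add: eis_psi_eq word_simps)
  have R2: "eis_phi G x g h \<otimes> eis_psi G x g z = \<one>"
    if gh: "g \<in> ?N" "h \<in> ?N" and z: "z = under_neg ?M (eis_phi G x g h) g h" for g h z
    unfolding z under_neg_eis_phi[OF gh] using gh[THEN derived_in_carrier] x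
    by (simp add: eis_phi_eq eis_psi_eq word_simps)
  have R3: "eis_phi G x b a \<otimes> act ?M b (eis_phi G x t z) \<otimes> eis_phi G x t b =
      act ?M a (eis_phi G x t b) \<otimes> eis_phi G x t a \<otimes> act ?M t (eis_phi G x v w)"
    if abt: "a \<in> ?N" "b \<in> ?N" "t \<in> ?N" and zvw: "z = under_neg ?M (eis_phi G x b a) b a"
      "v = under_neg ?M (eis_phi G x t b) t b" "w = under_neg ?M (eis_phi G x t a) t a"
    for a b t z v w
  proof -
    have c: "a \<in> carrier G" "b \<in> carrier G" "t \<in> carrier G"
      using abt derived_in_carrier by auto
    note zvw' = zvw[unfolded under_neg_eis_phi[OF abt(2,1)] under_neg_eis_phi[OF abt(3,2)]
        under_neg_eis_phi[OF abt(3,1)]]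
    \<comment> \<open>\<open>act\<close> is restricted to the derived group, so \<open>z\<close>,
      \<open>v\<close> and \<open>w\<close> have to be located there before the conjugations can be
      unfolded.\<close>
    have N: "z \<in> ?N" "v \<in> ?N" "w \<in> ?N"
      unfolding zvw' using under_neg_in_derived abt by blast+
    note N' = N[THEN derived_in_carrier]
    show ?thesis
      unfolding act[OF abt(2) eis_phi_in_derived[OF abt(3) N(1)]]
        act[OF abt(1) eis_phi_in_derived[OF abt(3,2)]] act[OF abt(3) eis_phi_in_derived[OF N(2,3)]]
      unfolding eis_phi_eq[OF c(2,1)] eis_phi_eq[OF c(3) N'(1)] eis_phi_eq[OF c(3,2)] eis_phi_eq[OF c(3,1)]
        eis_phi_eq[OF N'(2,3)]
      unfolding zvw'
      \<comment> \<open>Both sides are now words in \<open>a\<close>, \<open>b\<close>,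
        \<open>t\<close>, \<open>x\<close>, and they agree in the free group on these
        letters.\<close>
      using c x by (simp add: word_simps)
  qed
  show ?thesis
    unfolding unframed_Reidemeister_pair_def Let_def
    using eis_phi_in_derived eis_psi_in_derived R1 R2 R3
    by (simp add: id_xmod_def derived_group_simps)
qed

end


section \<open>Homomorphisms out of a presented group\<close>

fun eval_letter :: "('a, 'm) monoid_scheme \<Rightarrow> ('s \<Rightarrow> 'a) \<Rightarrow> 's \<times> bool \<Rightarrow> 'a" where
  "eval_letter G h (s, b) = (if b then h s else inv\<^bsub>G\<^esub> (h s))"

definition eval_word :: "('a, 'm) monoid_scheme \<Rightarrow> ('s \<Rightarrow> 'a) \<Rightarrow> 's word \<Rightarrow> 'a" where
  "eval_word G h w = foldr (\<lambda>l a. eval_letter G h l \<otimes>\<^bsub>G\<^esub> a) w \<one>\<^bsub>G\<^esub>"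

text \<open>Extensionality makes a solution the same thing as its values on \<open>S\<close>, so
  that solutions can be counted.\<close>

definition solutions ::
  "('a, 'm) monoid_scheme \<Rightarrow> 's set \<Rightarrow> ('s word \<times> 's word) set \<Rightarrow> ('s \<Rightarrow> 'a) set" where
  "solutions G S R =
    {h \<in> S \<rightarrow>\<^sub>E carrier G. \<forall>(r, r')\<in>R. eval_word G h r = eval_word G h r'}"

lemma eval_word_simps [simp]:
  "eval_word G h [] = \<one>\<^bsub>G\<^esub>"
  "eval_word G h (l # w) = eval_letter G h l \<otimes>\<^bsub>G\<^esub> eval_word G h w"
  by (simp_all add: eval_word_def)

lemma word_class_self: "w \<in> words S \<Longrightarrow> w \<in> word_class S R w"
  by (simp add: word_class_def word_cong.refl)

lemma carrier_presented: "carrier (presented_group S R) = word_class S R ` words S"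
  by (auto simp: presented_group_def quotient_def word_class_def)

context group
begin

lemma eval_letter_closed:
  "h \<in> S \<rightarrow> carrier G \<Longrightarrow> l \<in> S \<times> UNIV \<Longrightarrow> eval_letter G h l \<in> carrier G"
  by (cases l) auto

lemma eval_word_closed:
  "h \<in> S \<rightarrow> carrier G \<Longrightarrow> w \<in> words S \<Longrightarrow> eval_word G h w \<in> carrier G"
proof (induction w)
  case (Cons l w)
  then show ?case using eval_letter_closed[of h S l] by simp
qed simp

lemma eval_word_append:
  "h \<in> S \<rightarrow> carrier G \<Longrightarrow> v \<in> words S \<Longrightarrow> w \<in> words S \<Longrightarrow>
    eval_word G h (v @ w) = eval_word G h v \<otimes> eval_word G h w"
proof (induction v)
  case (Cons l v)
  then show ?case
    using eval_letter_closed[of h S l] eval_word_closed[of h S] by (simp add: m_assoc)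
qed (simp add: eval_word_closed)

lemma eval_word_cong:
  assumes R: "R \<subseteq> words S \<times> words S" and h: "h \<in> solutions G S R"
    and "(v, w) \<in> word_cong S R"
  shows "eval_word G h v = eval_word G h w"
  using assms(3)
proof (induction rule: word_cong.induct)
  have hS: "h \<in> S \<rightarrow> carrier G" using h by (auto simp: solutions_def)
  note closed = eval_word_closed[OF hS] and append = eval_word_append[OF hS]
  {
    case (cancel u v s b)
    then have "h s \<in> carrier G" using hS by auto
    with cancel have "eval_word G h ([(s, b), (s, \<not> b)] @ v) = eval_word G h v"
      by (simp add: closed inv_cancel_left)
    with cancel show ?case by (simp add: append del: eval_word_simps)
  next
    case (relation u v r r')
    with R have "r \<in> words S" "r' \<in> words S" by auto
    with relation h show ?case by (auto simp: append solutions_def)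
  }
qed auto

text \<open>Induction on the word. The only point beyond the homomorphism property is that the class
  of an inverse letter is the inverse of the class of the letter, which comes from a free
  cancellation.\<close>

lemma hom_eq_eval_word:
  assumes R: "R \<subseteq> words S \<times> words S" and f: "f \<in> hom (presented_group S R) G"
    and "w \<in> words S"
  shows "f (word_class S R w) = eval_word G (\<lambda>s\<in>S. f (word_class S R [(s, True)])) w"
  using assms(3)
proof (induction w)
  interpret P: group "presented_group S R" by (rule group_presented_group[OF R])
  interpret f: group_hom "presented_group S R" G f by unfold_locales (rule f)
  have one: "word_class S R [] = \<one>\<^bsub>presented_group S R\<^esub>" by (simp add: presented_group_def)
  {
    case Nil
    then show ?case by (simp add: one)
  next
    case (Cons l w)
    obtain s b where l: "l = (s, b)" by force
    with Cons have s: "s \<in> S" and w: "w \<in> words S" by auto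
    have gen: "word_class S R [(s, c)] \<in> carrier (presented_group S R)" for c
      using s by (auto simp: carrier_presented)
    have "([(s, True), (s, False)], []) \<in> word_cong S R"
      using word_cong.cancel[of "[]" S "[]" s True R] s by simp
    then have "word_class S R [(s, True), (s, False)] = word_class S R []"
      unfolding word_class_def by (rule equiv_class_eq[OF equiv_word_cong[OF R]])
    then have "word_class S R [(s, True)] \<otimes>\<^bsub>presented_group S R\<^esub> word_class S R [(s, False)] =
        \<one>\<^bsub>presented_group S R\<^esub>"
      using s presented_mult[OF R, of "[(s, True)]" "[(s, False)]"] by (simp add: one)
    then have "word_class S R [(s, False)] = inv\<^bsub>presented_group S R\<^esub> word_class S R [(s, True)]"
      using gen by (metis P.inv_equality P.inv_comm)
    then have letter: "f (word_class S R [l]) = eval_letter G (\<lambda>s\<in>S. f (word_class S R [(s, True)])) l"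
      using gen s by (auto simp: l f.hom_inv)
    have "word_class S R (l # w) =
        word_class S R [l] \<otimes>\<^bsub>presented_group S R\<^esub> word_class S R w"
      using presented_mult[OF R, of "[l]" w] s w by (simp add: l)
    moreover have "word_class S R w \<in> carrier (presented_group S R)"
      using w by (auto simp: carrier_presented)
    ultimately have "f (word_class S R (l # w)) = f (word_class S R [l]) \<otimes> f (word_class S R w)"
      using gen by (simp add: l)
    then show ?case by (simp only: eval_word_simps letter Cons.IH)
  }
qed

text \<open>The universal property of a presentation, put as a bijection so that homomorphisms can
  be counted by the images of the generators.\<close>

lemma bij_betw_hom_solutions:
  assumes R: "R \<subseteq> words S \<times> words S"
  defines "P \<equiv> presented_group S R"
  shows "bij_betw (\<lambda>f. \<lambda>s\<in>S. f (word_class S R [(s, True)]))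
    (hom P G \<inter> extensional (carrier P)) (solutions G S R)"
proof (rule bij_betwI')
  fix f f' assume f: "f \<in> hom P G \<inter> extensional (carrier P)"
    and f': "f' \<in> hom P G \<inter> extensional (carrier P)"
  have "f = f'" if eq: "(\<lambda>s\<in>S. f (word_class S R [(s, True)])) =
      (\<lambda>s\<in>S. f' (word_class S R [(s, True)]))"
  proof (rule extensionalityI[of _ "carrier P"])
    fix A assume "A \<in> carrier P"
    then obtain w where "w \<in> words S" "A = word_class S R w"
      by (auto simp: P_def carrier_presented)
    then show "f A = f' A"
      using hom_eq_eval_word[OF R, of f w] hom_eq_eval_word[OF R, of f' w] f f' eq
      by (simp add: P_def)
  qed (use f f' in auto)
  then show "((\<lambda>s\<in>S. f (word_class S R [(s, True)])) =
      (\<lambda>s\<in>S. f' (word_class S R [(s, True)]))) = (f = f')" by auto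
next
  fix f assume "f \<in> hom P G \<inter> extensional (carrier P)"
  then have f: "f \<in> hom (presented_group S R) G" by (simp add: P_def)
  have "eval_word G (\<lambda>s\<in>S. f (word_class S R [(s, True)])) r =
      eval_word G (\<lambda>s\<in>S. f (word_class S R [(s, True)])) r'" if r: "(r, r') \<in> R" for r r'
  proof -
    have "(r, r') \<in> word_cong S R" using word_cong.relation[of "[]" S "[]" r r' R] r by simp
    then have "word_class S R r = word_class S R r'"
      unfolding word_class_def by (rule equiv_class_eq[OF equiv_word_cong[OF R]])
    moreover have "r \<in> words S" "r' \<in> words S" using R r by auto
    ultimately show ?thesis by (simp flip: hom_eq_eval_word[OF R f])
  qed
  moreover have "f (word_class S R [(s, True)]) \<in> carrier G" if "s \<in> S" for s
    using that f by (auto simp: carrier_presented intro!: hom_in_carrier[OF f])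
  ultimately show "(\<lambda>s\<in>S. f (word_class S R [(s, True)])) \<in> solutions G S R"
    by (auto simp: solutions_def)
next
  fix h assume h: "h \<in> solutions G S R"
  then have hS: "h \<in> S \<rightarrow> carrier G" by (auto simp: solutions_def)
  \<comment> \<open>A representative of each class is chosen here; \<open>eval_word_cong\<close>
    makes the value independent of the choice.\<close>
  define f where "f = (\<lambda>A\<in>carrier P. eval_word G h (SOME w. w \<in> words S \<and> A = word_class S R w))"
  have f: "f (word_class S R w) = eval_word G h w" if w: "w \<in> words S" for w
  proof -
    let ?v = "SOME v. v \<in> words S \<and> word_class S R w = word_class S R v"
    have v: "?v \<in> words S \<and> word_class S R w = word_class S R ?v"
      by (rule someI[of _ w]) (use w in simp)
    then have "(w, ?v) \<in> word_cong S R"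
      using word_class_self[of ?v S R] by (simp add: word_class_def)
    with w show ?thesis
      using eval_word_cong[OF R h] by (auto simp: f_def P_def carrier_presented)
  qed
  have "f \<in> hom P G"
  proof (rule homI)
    fix A B assume "A \<in> carrier P" "B \<in> carrier P"
    then obtain v w where "v \<in> words S" "A = word_class S R v" "w \<in> words S" "B = word_class S R w"
      by (auto simp: P_def carrier_presented)
    then show "f (A \<otimes>\<^bsub>P\<^esub> B) = f A \<otimes> f B"
      by (simp add: P_def presented_mult[OF R] f eval_word_append[OF hS])
  qed (use f eval_word_closed[OF hS] in \<open>force simp: P_def carrier_presented\<close>)
  moreover have "(\<lambda>s\<in>S. f (word_class S R [(s, True)])) = h"
  proof (rule extensionalityI[of _ S])
    fix s assume "s \<in> S"
    moreover from this have "h s \<in> carrier G" using hS by auto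
    ultimately show "(\<lambda>s\<in>S. f (word_class S R [(s, True)])) s = h s" by (simp add: f)
  qed (use h in \<open>auto simp: solutions_def PiE_iff\<close>)
  ultimately show "\<exists>f \<in> hom P G \<inter> extensional (carrier P).
      h = (\<lambda>s\<in>S. f (word_class S R [(s, True)]))"
    by (intro bexI[of _ f]) (auto simp: f_def)
qed

end


section \<open>The knot as a path\<close>

text \<open>Walk from \<open>a\<close> along \<open>S\<close> until \<open>b\<close>. Connectedness
  yields only zigzags, but a zigzag never leaves the walk: forward steps follow it, backward steps
  retrace it since predecessors are unique, and \<open>a\<close> has no predecessor.\<close>

lemma functional_relation_path:
  fixes S :: "('a \<times> 'a) set"
  assumes P: "a \<in> P" "b \<in> P" "S \<subseteq> P \<times> P" and sv: "single_valued S" "single_valued (S\<inverse>)"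
    and dom: "Domain S = P - {b}" and ran: "a \<notin> Range S"
    and conn: "P \<times> P \<subseteq> (S \<union> S\<inverse>)\<^sup>*"
  obtains p :: "nat \<Rightarrow> 'a" and N where
    "bij_betw p {..N} P" "p 0 = a" "p N = b" "S = {(p t, p (Suc t)) | t. t < N}"
proof -
  define f where "f q = (SOME r. (q, r) \<in> S)" for q
  have f: "(q, f q) \<in> S" if "q \<in> P" "q \<noteq> b" for q
  proof -
    have "\<exists>r. (q, r) \<in> S" using dom that by blast
    then show ?thesis unfolding f_def by (rule someI_ex)
  qed
  have f_eq: "f q = r" if "(q, r) \<in> S" for q r
    using sv(1) that unfolding f_def by (metis single_valuedD someI)
  define p where "p t = (f ^^ t) a" for t
  have p_Suc: "p (Suc t) = f (p t)" for t by (simp add: p_def)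
  have p_in: "p t \<in> P" if "\<forall>u<t. p u \<noteq> b" for t
    using that
  proof (induction t)
    case (Suc t)
    then show ?case using f[of "p t"] P(3) by (auto simp: p_Suc)
  qed (simp add: p_def P)
  \<comment> \<open>The condition on earlier times keeps the walk from having passed
    \<open>b\<close>, where the value of \<open>f\<close> is arbitrary.\<close>
  have reach: "\<exists>t. q = p t \<and> (\<forall>u<t. p u \<noteq> b)" if "q \<in> P" for q
  proof -
    have "(a, q) \<in> (S \<union> S\<inverse>)\<^sup>*" using conn P that by blast
    then show ?thesis
    proof (induction rule: rtrancl_induct)
      case base
      show ?case by (intro exI[of _ 0]) (simp add: p_def)
    next
      case (step q r)
      from step.IH obtain t where t: "q = p t" "\<forall>u<t. p u \<noteq> b" by (elim exE conjE)
      from step.hyps(2) show ?case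
      proof
        assume qr: "(q, r) \<in> S"
        then have "q \<noteq> b" using dom by blast
        then show ?thesis
          using t f_eq[OF qr] by (intro exI[of _ "Suc t"]) (simp add: p_Suc less_Suc_eq all_conj_distrib)
      next
        assume rq: "(q, r) \<in> S\<inverse>"
        have "t \<noteq> 0"
        proof
          assume "t = 0"
          then have "q = a" using t(1) by (simp add: p_def)
          then show False using rq ran by auto
        qed
        then obtain u where u: "t = Suc u" by (cases t) auto
        have "(p u, q) \<in> S" using f[OF p_in[of u]] t by (simp add: u p_Suc)
        then have "r = p u" using rq sv(2) by (auto dest: single_valuedD)
        then show ?thesis using t(2) by (intro exI[of _ u]) (simp add: u)
      qed
    qed
  qed
  obtain N where N: "p N = b" "\<forall>u<N. p u \<noteq> b" using reach[OF P(2)] by metis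
  have "inj_on p {..N}"
  proof (rule linorder_inj_onI)
    fix s t assume st: "s < t" "s \<in> {..N}" "t \<in> {..N}"
    show "p s \<noteq> p t"
    proof
      assume "p s = p t"
      \<comment> \<open>Iterating \<open>f\<close> another \<open>N - t\<close> times moves the
        coincidence to time \<open>N\<close>: the value \<open>b\<close> would already occur at the
        earlier time \<open>N - t + s\<close>.\<close>
      then have "(f ^^ (N - t)) (p s) = (f ^^ (N - t)) (p t)" by simp
      then have "p (N - t + s) = p (N - t + t)" by (simp add: p_def funpow_add)
      then show False using N st by auto
    qed
  qed auto
  moreover have "p ` {..N} = P"
  proof (intro equalityI subsetI)
    fix q assume "q \<in> P"
    then obtain t where "q = p t" "\<forall>u<t. p u \<noteq> b" using reach by blast
    with N(1) show "q \<in> p ` {..N}" by (metis atMost_iff imageI not_le)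
  qed (use p_in N in auto)
  moreover have "S = {(p t, p (Suc t)) | t. t < N}"
  proof (intro equalityI subrelI)
    fix q r assume qr: "(q, r) \<in> S"
    then have "q \<in> P" "q \<noteq> b" using dom by auto
    then obtain t where "q = p t" "t \<le> N" using \<open>p ` {..N} = P\<close> by auto
    moreover from this have "t < N" using \<open>q \<noteq> b\<close> N(1) by (auto simp: le_less)
    ultimately show "(q, r) \<in> {(p t, p (Suc t)) | t. t < N}" using f_eq[OF qr] by (auto simp: p_Suc)
  next
    fix q r assume "(q, r) \<in> {(p t, p (Suc t)) | t. t < N}"
    then show "(q, r) \<in> S" using f[OF p_in] N by (auto simp: p_Suc)
  qed
  ultimately show ?thesis using N by (intro that[of p N]) (auto simp: bij_betw_def p_def)
qed

section \<open>A path cut at some of its steps\<close>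

locale cut_path =
  fixes p :: "nat \<Rightarrow> 'a" and N :: nat and U :: "'a set"
  assumes inj: "inj_on p {..N}" and U: "U \<subseteq> p ` {..<N}"
begin

text \<open>A cut is made on the step that leaves a point of \<open>U\<close>. A point of
  \<open>U\<close> therefore still belongs to the piece that ends there, and
  \<open>cuts_before t\<close> numbers the piece containing \<open>p t\<close>, starting from
  0.\<close>

definition cuts_before :: "nat \<Rightarrow> nat" where
  "cuts_before t = card {u. u < t \<and> p u \<in> U}"

definition uncut :: "('a \<times> 'a) set" where
  "uncut = {(p t, p (Suc t)) | t. t < N \<and> p t \<notin> U}"

lemma cuts_before_0 [simp]: "cuts_before 0 = 0"
  by (simp add: cuts_before_def)

lemma cuts_before_Suc [simp]:
  "cuts_before (Suc t) = (if p t \<in> U then Suc (cuts_before t) else cuts_before t)"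
proof -
  have "{u. u < Suc t \<and> p u \<in> U} =
      (if p t \<in> U then insert t {u. u < t \<and> p u \<in> U} else {u. u < t \<and> p u \<in> U})"
    by (auto simp: less_Suc_eq)
  then show ?thesis by (simp add: cuts_before_def)
qed

lemma cuts_before_mono: "s \<le> t \<Longrightarrow> cuts_before s \<le> cuts_before t"
  by (rule lift_Suc_mono_le[of cuts_before]) auto

text \<open>The count starts at 0 and rises by one at each cut, so it equals \<open>k\<close> at the
  cut that raises it to \<open>Suc k\<close>.\<close>

lemma ex_cut:
  assumes "k < cuts_before t"
  shows "\<exists>u<t. p u \<in> U \<and> cuts_before u = k"
  using assms by (induction t) (auto simp: less_Suc_eq split: if_splits)

lemma uncut_connected_le:
  assumes "s \<le> t" "t \<le> N" "cuts_before s = cuts_before t"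
  shows "(p s, p t) \<in> uncut\<^sup>*"
  using assms
proof (induction t rule: dec_induct)
  case (step t)
  have "cuts_before s \<le> cuts_before t" using step by (intro cuts_before_mono) simp
  with step have "p t \<notin> U" "cuts_before s = cuts_before t" by (auto split: if_splits)
  with step have "(p t, p (Suc t)) \<in> uncut" "(p s, p t) \<in> uncut\<^sup>*" by (auto simp: uncut_def)
  then show ?case by (rule rtrancl_into_rtrancl[rotated])
qed simp

text \<open>Uncut steps leave the count unchanged in both directions; conversely, equal counts leave
  no cut between the two times. Injectivity of \<open>p\<close> recovers a time from its
  point.\<close>

lemma uncut_connected_iff:
  assumes st: "s \<le> N" "t \<le> N"
  shows "(p s, p t) \<in> (uncut \<union> uncut\<inverse>)\<^sup>* \<longleftrightarrow> cuts_before s = cuts_before t"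
proof
  assume eq: "cuts_before s = cuts_before t"
  have sub: "uncut\<^sup>* \<subseteq> (uncut \<union> uncut\<inverse>)\<^sup>*" "(uncut\<^sup>*)\<inverse> \<subseteq> (uncut \<union> uncut\<inverse>)\<^sup>*"
    unfolding rtrancl_converse[symmetric] by (intro rtrancl_mono; simp)+
  show "(p s, p t) \<in> (uncut \<union> uncut\<inverse>)\<^sup>*"
  proof (cases "s \<le> t")
    case True
    with eq st uncut_connected_le[of s t] sub show ?thesis by blast
  next
    case False
    with eq st uncut_connected_le[of t s] sub show ?thesis by auto
  qed
next
  assume "(p s, p t) \<in> (uncut \<union> uncut\<inverse>)\<^sup>*"
  then have "\<exists>u\<le>N. p t = p u \<and> cuts_before s = cuts_before u"
  proof (induction rule: rtrancl_induct)
    case base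
    then show ?case using st by auto
  next
    case (step q r)
    then obtain u where u: "u \<le> N" "q = p u" "cuts_before s = cuts_before u" by auto
    from step(2) show ?case
    proof
      assume "(q, r) \<in> uncut"
      then obtain v where v: "q = p v" "r = p (Suc v)" "v < N" "p v \<notin> U" by (auto simp: uncut_def)
      with u inj have "u = v" by (auto dest: inj_onD)
      with u v show ?thesis by (intro exI[of _ "Suc v"]) auto
    next
      assume "(q, r) \<in> uncut\<inverse>"
      then obtain v where v: "r = p v" "q = p (Suc v)" "v < N" "p v \<notin> U" by (auto simp: uncut_def)
      with u inj have "u = Suc v" by (auto dest: inj_onD)
      with u v show ?thesis by (intro exI[of _ v]) auto
    qed
  qed
  then show "cuts_before s = cuts_before t" using inj st by (auto dest: inj_onD)
qed

text \<open>At all times after a cut the count exceeds its value at that cut.\<close>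

lemma cut_eqI:
  assumes "s \<le> N" "t \<le> N" "p s \<in> U" "p t \<in> U" "cuts_before s = cuts_before t"
  shows "s = t"
proof (rule ccontr)
  assume "s \<noteq> t"
  then consider "Suc s \<le> t" | "Suc t \<le> s" by linarith
  then show False using cuts_before_mono[of "Suc s" t] cuts_before_mono[of "Suc t" s] assms
    by cases auto
qed

end

section \<open>Levels of a diagram and the matching of points within a strip\<close>

lemma level_eq_strip_top:
  assumes "tangle_diagram [Dn] D [Dn]" "i < length D"
  shows "level D i = strip_top (D ! i)"
proof -
  \<comment> \<open>The top word is generalised from \<open>[Dn]\<close>, since the induction
    removes the first strip.\<close>
  have "(if i = 0 then us else strip_bot (D ! (i - 1))) = strip_top (D ! i)"
    if "tangle_diagram us D vs" "i < length D" for us vs and D :: diagram and i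
    using that
  proof (induction D arbitrary: us i)
    case (Cons s D)
    show ?case
    proof (cases i)
      case (Suc j)
      with Cons.IH[of "strip_bot s" j] Cons.prems show ?thesis by (cases j) auto
    qed (use Cons.prems in simp)
  qed simp
  with assms show ?thesis by (simp add: level_def)
qed

lemma level_Suc: "level D (Suc i) = strip_bot (D ! i)"
  by (simp add: level_def)

lemma level_last:
  assumes "tangle_diagram [Dn] D [Dn]"
  shows "level D (length D) = [Dn]"
proof -
  have "(if D = [] then us else strip_bot (D ! (length D - 1))) = vs"
    if "tangle_diagram us D vs" for us vs and D :: diagram
    using that
  proof (induction D arbitrary: us)
    case (Cons s D)
    from Cons.IH[of "strip_bot s"] Cons.prems show ?case by (cases D) auto
  qed simp
  with assms show ?thesis by (auto simp: level_def)
qed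

text \<open>Following the orientation of the knot, the point \<open>p\<close> leaves into strip \<open>i\<close>, respectively is
  reached through strip \<open>i\<close>. Every strip matches its boundary points in pairs, so
  \<open>next_point\<close> below is a partial injection.\<close>

definition departs :: "diagram \<Rightarrow> point \<Rightarrow> nat \<Rightarrow> bool" where
  "departs D p i \<longleftrightarrow> (case level D (fst p) ! snd p of Dn \<Rightarrow> fst p = i | Up \<Rightarrow> fst p = Suc i)"

definition enters :: "diagram \<Rightarrow> point \<Rightarrow> nat \<Rightarrow> bool" where
  "enters D p i \<longleftrightarrow> (case level D (fst p) ! snd p of Dn \<Rightarrow> fst p = Suc i | Up \<Rightarrow> fst p = i)"

definition strip_joins :: "diagram \<Rightarrow> nat \<Rightarrow> (point \<times> point) set" where
  "strip_joins D i = joins i (D ! i) \<union>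
     (if i \<in> crossings D then {(under_top D i, under_bot D i)} else {})"

definition next_point :: "diagram \<Rightarrow> (point \<times> point) set" where
  "next_point D = {(p, q). \<exists>i<length D. (p, q) \<in> strip_joins D i \<union> (strip_joins D i)\<inverse> \<and>
     departs D p i \<and> enters D q i}"

lemma departs_enters: "departs D p i \<Longrightarrow> \<not> enters D p i"
  by (auto simp: departs_def enters_def split: orient.splits)

lemma departs_unique: "departs D p i \<Longrightarrow> departs D p j \<Longrightarrow> i = j"
  by (auto simp: departs_def split: orient.splits)

lemma enters_unique: "enters D p i \<Longrightarrow> enters D p j \<Longrightarrow> i = j"
  by (auto simp: enters_def split: orient.splits)

lemma strand_joins_eq: "strand_joins D = (\<Union>i<length D. strip_joins D i)"
  by (auto simp: strand_joins_def arc_joins_def strip_joins_def crossings_def split: if_splits)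

text \<open>Once the under-strand is added, the two kinds of crossing join the same end-points and
  differ only in which strand is over. The matching can thus be studied without regard to
  signs.\<close>

lemma strip_joins_eq:
  assumes "i < length D"
  defines "l \<equiv> length (lefts (D ! i))"
  shows "strip_joins D i =
    {((i, k), (Suc i, k)) | k. k < l} \<union>
    {((i, l + length (piece_top (mid (D ! i))) + k), (Suc i, l + length (piece_bot (mid (D ! i))) + k)) | k.
        k < length (rights (D ! i))} \<union>
    (case mid (D ! i) of
       None \<Rightarrow> {}
     | Some (Cup _) \<Rightarrow> {((i, l), (i, Suc l))}
     | Some (Cap _) \<Rightarrow> {((Suc i, l), (Suc i, Suc l))}
     | _ \<Rightarrow> {((i, Suc l), (Suc i, l)), ((i, l), (Suc i, Suc l))})"
  using assms
  by (auto simp: strip_joins_def joins_def crossings_def under_top_def under_bot_def positive_def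
      Let_def split: option.splits piece.splits)

lemma strip_joins_partner_unique:
  assumes "i < length D" "(p, q) \<in> strip_joins D i \<union> (strip_joins D i)\<inverse>"
    "(p, r) \<in> strip_joins D i \<union> (strip_joins D i)\<inverse>"
  shows "q = r"
  using assms(2,3) unfolding strip_joins_eq[OF assms(1)]
  by (cases "mid (D ! i)" rule: piece_top.cases) auto

context
  fixes D assumes D: "tangle_diagram [Dn] D [Dn]"
begin

text \<open>The third claim is the consistency of orientations: vertical and crossing strands join
  different levels with equal orientations, cups and caps join two points of one level with opposite
  ones.\<close>

lemma strip_joins_points:
  assumes i: "i < length D" and pq: "(p, q) \<in> strip_joins D i"
  shows "p \<in> points D" "q \<in> points D"
    "(departs D p i \<and> enters D q i) \<or> (departs D q i \<and> enters D p i)"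
proof -
  note lev = level_eq_strip_top[OF D i] level_Suc[of D i]
  note simps = points_def lev strip_top_def strip_bot_def
  show "p \<in> points D" "q \<in> points D"
    using i pq unfolding strip_joins_eq[OF i]
    by (cases "mid (D ! i)" rule: piece_top.cases; force simp: simps)+
  show "(departs D p i \<and> enters D q i) \<or> (departs D q i \<and> enters D p i)"
    using i pq unfolding strip_joins_eq[OF i]
    by (cases "mid (D ! i)" rule: piece_top.cases)
      (auto simp: simps departs_def enters_def nth_append split: orient.splits; 
       (metis flip.simps orient.distinct)?)+
qed

lemma strip_joins_partner:
  assumes i: "i < length D" and "p \<in> points D" "fst p = i \<or> fst p = Suc i"
  shows "\<exists>q. (p, q) \<in> strip_joins D i \<union> (strip_joins D i)\<inverse>"
proof -
  define l where "l = length (lefts (D ! i))"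
  define r where "r = length (rights (D ! i))"
  obtain j k where p: "p = (j, k)" by force
  have k: "if j = i then k < l + length (piece_top (mid (D ! i))) + r
      else k < l + length (piece_bot (mid (D ! i))) + r"
    using assms level_eq_strip_top[OF D i] level_Suc[of D i]
    by (auto simp: p points_def strip_top_def strip_bot_def l_def r_def)
  define a where "a = length (piece_top (mid (D ! i)))"
  define b where "b = length (piece_bot (mid (D ! i)))"
  note eq = strip_joins_eq[OF i, folded l_def r_def a_def b_def]
  consider "k < l" | "l \<le> k" "k < l + (if j = i then a else b)"
    | m where "k = l + (if j = i then a else b) + m" "m < r"
  proof (cases "k < l + (if j = i then a else b)")
    case False
    then show ?thesis
      using that(3)[of "k - (l + (if j = i then a else b))"] k
      by (auto simp: a_def b_def split: if_splits)
  qed (use that in linarith)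
  then show ?thesis
  proof cases
    case 1
    then show ?thesis
      using assms(3) by (intro exI[of _ "(if j = i then Suc i else i, k)"]) (auto simp: eq p)
  next
    case 2
    \<comment> \<open>A piece has at most two end-points on a level, so the partner is at the other
      of the two positions: on the same level for a cup or cap, on the opposite level for a
      crossing.\<close>
    let ?k = "if k = l then Suc l else l"
    have "length (piece_top (mid (D ! i))) \<le> 2" "length (piece_bot (mid (D ! i))) \<le> 2"
      by (cases "mid (D ! i)" rule: piece_top.cases; simp)+
    with 2 have "k = l \<or> k = Suc l" by (auto simp: a_def b_def split: if_splits)
    then show ?thesis
      using assms(3) 2(2)
      by (intro exI[of _ "(case mid (D ! i) of Some (Cup _) \<Rightarrow> j | Some (Cap _) \<Rightarrow> j
            | _ \<Rightarrow> (if j = i then Suc i else i), ?k)"], cases "mid (D ! i)" rule: piece_top.cases)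
        (auto simp: eq p a_def b_def)
  next
    case 3
    then show ?thesis
      using assms(3)
      by (intro exI[of _ "if j = i then (Suc i, l + b + m) else (i, l + a + m)"]) (auto simp: eq p)
  qed
qed

end

context
  fixes D assumes D: "tangle_diagram [Dn] D [Dn]"
begin

lemma level_ends:
  "level D 0 ! 0 = Dn" "level D (length D) ! 0 = Dn"
proof -
  show "level D 0 ! 0 = Dn" by (simp add: level_def)
  show "level D (length D) ! 0 = Dn" by (simp add: level_last[OF D])
qed

lemma next_point_points: "next_point D \<subseteq> points D \<times> points D"
  using strip_joins_points[OF D] by (fastforce simp: next_point_def)

text \<open>This transfers connectedness from the undirected strands to the oriented
  relation.\<close>

lemma next_point_sym: "next_point D \<union> (next_point D)\<inverse> = strand_joins D \<union> (strand_joins D)\<inverse>"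
proof (intro equalityI subrelI)
  fix p q assume "(p, q) \<in> strand_joins D \<union> (strand_joins D)\<inverse>"
  then obtain i where i: "i < length D" "(p, q) \<in> strip_joins D i \<or> (q, p) \<in> strip_joins D i"
    unfolding strand_joins_eq by blast
  then have "departs D p i \<and> enters D q i \<or> departs D q i \<and> enters D p i"
    using strip_joins_points(3)[OF D i(1)] by blast
  with i show "(p, q) \<in> next_point D \<union> (next_point D)\<inverse>"
    by (auto simp: next_point_def)
qed (auto simp: next_point_def strand_joins_eq)

lemma single_valued_next_point: "single_valued (next_point D)" "single_valued ((next_point D)\<inverse>)"
proof -
  show "single_valued (next_point D)"
  proof (rule single_valuedI)
    fix p q r assume "(p, q) \<in> next_point D" "(p, r) \<in> next_point D"
    then obtain i j where "i < length D" "(p, q) \<in> strip_joins D i \<union> (strip_joins D i)\<inverse>"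
      "departs D p i" "(p, r) \<in> strip_joins D j \<union> (strip_joins D j)\<inverse>" "departs D p j"
      unfolding next_point_def by blast
    then show "q = r" using strip_joins_partner_unique departs_unique by metis
  qed
  show "single_valued ((next_point D)\<inverse>)"
  proof (rule single_valuedI)
    fix p q r assume "(p, q) \<in> (next_point D)\<inverse>" "(p, r) \<in> (next_point D)\<inverse>"
    then obtain i j where "i < length D" "(p, q) \<in> strip_joins D i \<union> (strip_joins D i)\<inverse>"
      "enters D p i" "(p, r) \<in> strip_joins D j \<union> (strip_joins D j)\<inverse>" "enters D p j"
      unfolding next_point_def by blast
    then show "q = r" using strip_joins_partner_unique enters_unique by metis
  qed
qed

text \<open>An upward point is never on the top level, and the last level carries only the bottom
  end-point. So every other point departs into some strip, where it has a partner, and the partner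
  must be entered.\<close>

lemma Domain_next_point: "Domain (next_point D) = points D - {(length D, 0)}"
proof (intro equalityI subsetI)
  fix p assume "p \<in> Domain (next_point D)"
  then obtain q i where "(p, q) \<in> next_point D" "departs D p i" "i < length D"
    by (auto simp: next_point_def)
  moreover from this have "p \<noteq> (length D, 0)" by (auto simp: departs_def level_ends)
  ultimately show "p \<in> points D - {(length D, 0)}" using next_point_points by blast
next
  fix p assume p: "p \<in> points D - {(length D, 0)}"
  obtain j k where jk: "p = (j, k)" by force
  have j: "j \<le> length D" "k < length (level D j)" using p by (auto simp: points_def jk)
  have "\<exists>i<length D. departs D p i"
  proof (cases "level D j ! k")
    case Dn
    have "j \<noteq> length D" using p j level_last[OF D] by (auto simp: jk)
    with j Dn show ?thesis by (intro exI[of _ j]) (simp add: departs_def jk)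
  next
    case Up
    have "j \<noteq> 0" using Up j by (intro notI) (auto simp: level_def)
    with j Up show ?thesis by (intro exI[of _ "j - 1"]) (auto simp: departs_def jk)
  qed
  then obtain i where i: "i < length D" "departs D p i" by blast
  then have "fst p = i \<or> fst p = Suc i" by (auto simp: departs_def split: orient.splits)
  then obtain q where q: "(p, q) \<in> strip_joins D i \<union> (strip_joins D i)\<inverse>"
    using strip_joins_partner[OF D i(1)] p by blast
  with i have "enters D q i"
    using strip_joins_points(3)[OF D i(1)] departs_enters by blast
  with q i have "(p, q) \<in> next_point D" unfolding next_point_def by blast
  then show "p \<in> Domain (next_point D)" by blast
qed

lemma top_not_in_Range: "(0, 0) \<notin> Range (next_point D)"
  by (auto simp: next_point_def enters_def level_ends)

lemma end_points: "(0, 0) \<in> points D" "(length D, 0) \<in> points D"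
  by (auto simp: points_def level_last[OF D]) (simp add: level_def)

text \<open>Both strands of a crossing are oriented downwards, so the knot runs from the top of the
  under-strand to its bottom.\<close>

lemma under_next_point:
  assumes "c \<in> crossings D"
  shows "(under_top D c, under_bot D c) \<in> next_point D"
proof -
  have c: "c < length D" using assms by (simp add: crossings_def)
  have "(under_top D c, under_bot D c) \<in> strip_joins D c"
    using assms by (simp add: strip_joins_def)
  moreover have "departs D (under_top D c) c" "enters D (under_bot D c) c"
    using assms level_eq_strip_top[OF D c]
    by (auto simp: departs_def enters_def under_top_def under_bot_def crossings_def positive_def
        Let_def strip_top_def level_Suc strip_bot_def nth_append)
  ultimately show ?thesis using c by (auto simp: next_point_def)
qed

end

section \<open>Arcs as the pieces of the knot between undercrossings\<close>

lemma joins_levels: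
  "(p, q) \<in> joins i s \<Longrightarrow> fst p \<le> fst q \<and> (fst p = i \<or> fst p = Suc i \<and> fst q = Suc i)"
  by (auto simp: joins_def Let_def split: option.splits piece.splits)

text \<open>A join between levels \<open>c\<close> and \<open>Suc c\<close> can come from strip
  \<open>c\<close> only, and there the crossing contributes just its over-strand.\<close>

lemma under_not_arc_join:
  assumes "c \<in> crossings D"
  shows "(under_top D c, under_bot D c) \<notin> arc_joins D \<union> (arc_joins D)\<inverse>"
proof -
  have "(under_top D c, under_bot D c) \<notin> joins c (D ! c)"
    using assms by (auto simp: joins_def under_top_def under_bot_def crossings_def positive_def Let_def)
  then show ?thesis
    using joins_levels[of "under_top D c" "under_bot D c"] joins_levels[of "under_bot D c" "under_top D c"]
    by (force simp: arc_joins_def under_top_def under_bot_def Let_def split: if_splits)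
qed

lemma inj_under_top: "under_top D c = under_top D d \<Longrightarrow> c = d"
  by (auto simp: under_top_def Let_def split: if_splits)

lemma equiv_arc_rel_UNIV: "equiv UNIV (arc_rel D)"
  unfolding arc_rel_def
  by (intro equivI refl_rtrancl trans_rtrancl sym_rtrancl sym_Un_converse) auto

lemma string_knot_path:
  assumes "string_knot_diagram D"
  obtains p N where "bij_betw p {..N} (points D)" "p 0 = (0, 0)" "p N = (length D, 0)"
    "next_point D = {(p t, p (Suc t)) | t. t < N}"
proof (rule functional_relation_path[of "(0, 0)" "points D" "(length D, 0)" "next_point D"])
  have D: "tangle_diagram [Dn] D [Dn]" and
    conn: "points D \<times> points D \<subseteq> (strand_joins D \<union> (strand_joins D)\<inverse>)\<^sup>*"
    using assms by (auto simp: string_knot_diagram_def)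
  show "points D \<times> points D \<subseteq> (next_point D \<union> (next_point D)\<inverse>)\<^sup>*"
    unfolding next_point_sym[OF D] by (rule conn)
  show "(0, 0) \<in> points D" "(length D, 0) \<in> points D" "next_point D \<subseteq> points D \<times> points D"
    "single_valued (next_point D)" "single_valued ((next_point D)\<inverse>)"
    "Domain (next_point D) = points D - {(length D, 0)}" "(0, 0) \<notin> Range (next_point D)"
    using end_points[OF D] next_point_points[OF D] single_valued_next_point[OF D]
      Domain_next_point[OF D] top_not_in_Range[OF D] by auto
qed (rule that)

text \<open>The path through all points is cut where it passes under a crossing. Its pieces are the
  arcs, numbered by the cuts before them, and induction along the path identifies this numbering
  with \<open>kth_arc\<close>.\<close>

lemma string_knot_arcs:
  assumes "string_knot_diagram D"
  obtains m where "num_arcs D = Suc m" "bij_betw (kth_arc D) {..m} (arcs D)"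
    "kth_arc D m = bot_arc D" "crossings D = kth_crossing D ` {..<m}"
    "\<And>k. k < m \<Longrightarrow> under_in D (kth_crossing D k) = kth_arc D k"
proof -
  have D: "tangle_diagram [Dn] D [Dn]"
    using assms by (auto simp: string_knot_diagram_def)
  obtain p N where p: "bij_betw p {..N} (points D)" "p 0 = (0, 0)" "p N = (length D, 0)"
    and S: "next_point D = {(p t, p (Suc t)) | t. t < N}"
    using string_knot_path[OF assms] .
  have inj: "inj_on p {..N}" using p(1) by (simp add: bij_betw_def)
  have step: "p (Suc t) = under_bot D c"
    if c: "c \<in> crossings D" and t: "t < N" "p t = under_top D c" for t c
  proof -
    obtain s where s: "s < N" "under_top D c = p s" "under_bot D c = p (Suc s)"
      using under_next_point[OF D c] unfolding S by blast
    then have "s = t" using t inj by (auto dest: inj_onD)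
    with s show ?thesis by simp
  qed
  define U where "U = under_top D ` crossings D"
  have cut: "under_top D c \<in> U" if "c \<in> crossings D" for c using that by (simp add: U_def)
  interpret cut_path p N U
  proof
    show "U \<subseteq> p ` {..<N}"
      using under_next_point[OF D] unfolding U_def S by fastforce
  qed (rule inj)
  have "arc_joins D \<union> (arc_joins D)\<inverse> = uncut \<union> uncut\<inverse>"
  proof -
    \<comment> \<open>A join inside an arc is never an under-step of the path, so a step of the path
      that is such a join is uncut.\<close>
    have 1: "(q, r) \<in> uncut"
      if qr: "(q, r) \<in> arc_joins D \<union> (arc_joins D)\<inverse>" "(q, r) \<in> next_point D" for q r
    proof -
      obtain t where t: "t < N" "q = p t" "r = p (Suc t)" using qr(2) unfolding S by blast
      have "p t \<notin> U"
        using step t qr(1) under_not_arc_join unfolding U_def by fastforce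
      with t show ?thesis by (auto simp: uncut_def)
    qed
    have 2: "(q, r) \<in> arc_joins D \<union> (arc_joins D)\<inverse>" if qr: "(q, r) \<in> uncut" for q r
    proof -
      obtain t where t: "t < N" "q = p t" "r = p (Suc t)" "p t \<notin> U"
        using qr by (auto simp: uncut_def)
      then have "(q, r) \<in> next_point D" unfolding S by blast
      then have "(q, r) \<in> strand_joins D \<union> (strand_joins D)\<inverse>" using next_point_sym[OF D] by blast
      moreover have "(q, r) \<noteq> (under_top D c, under_bot D c)" if "c \<in> crossings D" for c
        using that t by (auto simp: U_def)
      \<comment> \<open>The reverse of an under-step is excluded too: the path would run through the
        same two points in both directions.\<close>
      moreover have "(r, q) \<noteq> (under_top D c, under_bot D c)" if "c \<in> crossings D" for c
      proof
        assume "(r, q) = (under_top D c, under_bot D c)"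
        then have "(p (Suc t), p t) \<in> next_point D" using under_next_point[OF D that] t by simp
        then obtain s where "s < N" "p (Suc t) = p s" "p t = p (Suc s)" unfolding S by blast
        with t have "Suc t = s" "t = Suc s"
          using inj_onD[OF inj, of "Suc t" s] inj_onD[OF inj, of t "Suc s"] by simp_all
        then show False by simp
      qed
      ultimately show ?thesis by (auto simp: strand_joins_def)
    qed
    show ?thesis
    proof (intro equalityI subrelI)
      fix q r assume qr: "(q, r) \<in> arc_joins D \<union> (arc_joins D)\<inverse>"
      then have "(q, r) \<in> next_point D \<union> (next_point D)\<inverse>"
        unfolding next_point_sym[OF D] by (auto simp: strand_joins_def)
      then show "(q, r) \<in> uncut \<union> uncut\<inverse>" using 1[of q r] 1[of r q] qr by blast
    next
      fix q r assume "(q, r) \<in> uncut \<union> uncut\<inverse>"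
      then show "(q, r) \<in> arc_joins D \<union> (arc_joins D)\<inverse>" using 2[of q r] 2[of r q] by blast
    qed
  qed
  then have arc_eq: "arc_of D (p s) = arc_of D (p t) \<longleftrightarrow> cuts_before s = cuts_before t"
    if "s \<le> N" "t \<le> N" for s t
    using uncut_connected_iff[OF that] eq_equiv_class_iff[OF equiv_arc_rel_UNIV, of "p s" "p t" D]
    by (simp add: arc_of_def arc_rel_def)
  define m where "m = cuts_before N"
  \<comment> \<open>The description of \<open>kth_arc D k\<close> is an assumption here, because the
    induction that proves it below needs the crossing at the end of the \<open>k\<close>-th arc. The
    definite description in \<open>end_crossing\<close> is resolved by \<open>cut_eqI\<close>: a
    piece contains at most one cut.\<close>
  have kth: "\<exists>t c. t < N \<and> c \<in> crossings D \<and> p t = under_top D c \<and> cuts_before t = k \<and>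
      kth_crossing D k = c"
    if k: "k < m" "\<forall>t\<le>N. cuts_before t = k \<longrightarrow> kth_arc D k = arc_of D (p t)" for k
  proof -
    obtain t where t: "t < N" "p t \<in> U" "cuts_before t = k"
      using ex_cut[of k N] k(1) by (auto simp: m_def)
    then obtain c where c: "c \<in> crossings D" "p t = under_top D c" by (auto simp: U_def)
    have arc: "under_in D c = kth_arc D k" using k(2)[rule_format, of t] t by (simp add: under_in_def flip: c(2))
    have "end_crossing D (kth_arc D k) = c"
      unfolding end_crossing_def
    proof (rule the_equality)
      show "c \<in> crossings D \<and> under_in D c = kth_arc D k" using c arc by simp
      fix d assume d: "d \<in> crossings D \<and> under_in D d = kth_arc D k"
      then obtain s where s: "s < N" "p s = under_top D d"
        using under_next_point[OF D, of d] unfolding S by auto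
      with d arc t c have "cuts_before s = cuts_before t"
        using arc_eq[of s t] by (simp add: under_in_def)
      then have "s = t" using cut_eqI[of s t] s t d by (simp add: cut)
      then show "d = c" using s c inj_under_top by metis
    qed
    with t c show ?thesis by (auto simp: kth_crossing_def)
  qed
  have kth_arc: "\<forall>t\<le>N. cuts_before t = k \<longrightarrow> kth_arc D k = arc_of D (p t)" if "k \<le> m" for k
    using that
  proof (induction k)
    case 0
    then show ?case using arc_eq[of 0] p(2) by (auto simp: top_arc_def)
  next
    case (Suc k)
    then obtain t c where t: "t < N" "c \<in> crossings D" "p t = under_top D c" "cuts_before t = k"
      "kth_crossing D k = c" using kth[of k] by auto
    then have "kth_arc D (Suc k) = arc_of D (p (Suc t))"
      using step[of c t] by (simp add: kth_crossing_def under_out_def)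
    moreover have "cuts_before (Suc t) = Suc k" using t by (simp add: cut)
    ultimately show ?case using arc_eq[of "Suc t"] t by auto
  qed
  have occurs: "\<exists>t\<le>N. cuts_before t = k" if "k \<le> m" for k
  proof (cases "k = m")
    case False
    then have "k < cuts_before N" using that by (simp add: m_def)
    from ex_cut[OF this] obtain u where "u < N" "cuts_before u = k" by blast
    then show ?thesis by (intro exI[of _ u]) simp
  qed (auto simp: m_def)
  have bij: "bij_betw (kth_arc D) {..m} (arcs D)"
  proof (intro bij_betwI')
    fix j k assume jk: "j \<in> {..m}" "k \<in> {..m}"
    then obtain s t where "s \<le> N" "cuts_before s = j" "t \<le> N" "cuts_before t = k"
      using occurs[of j] occurs[of k] by auto
    then show "(kth_arc D j = kth_arc D k) = (j = k)"
      using arc_eq[of s t] kth_arc[of j] kth_arc[of k] jk by auto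
  next
    fix k assume "k \<in> {..m}"
    then obtain t where "t \<le> N" "kth_arc D k = arc_of D (p t)" using kth_arc[of k] occurs[of k] by auto
    moreover from this have "p t \<in> points D" using p(1) by (auto simp: bij_betw_def)
    ultimately show "kth_arc D k \<in> arcs D" by (auto simp: arcs_def arc_of_def intro: quotientI)
  next
    fix a assume "a \<in> arcs D"
    then obtain q where q: "q \<in> points D" "a = arc_of D q"
      by (auto simp: arcs_def arc_of_def elim: quotientE)
    then have "q \<in> p ` {..N}" using p(1) by (simp add: bij_betw_def)
    then obtain t where t: "t \<le> N" "a = arc_of D (p t)" using q by auto
    then have "cuts_before t \<le> m" unfolding m_def by (intro cuts_before_mono)
    then show "\<exists>k\<in>{..m}. a = kth_arc D k" using kth_arc t by auto
  qed
  show ?thesis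
  proof (rule that)
    show "num_arcs D = Suc m" using bij_betw_same_card[OF bij] by (simp add: num_arcs_def)
    show "kth_arc D m = bot_arc D" using kth_arc[of m] p(3) by (auto simp: m_def bot_arc_def)
    show "under_in D (kth_crossing D k) = kth_arc D k" if k: "k < m" for k
    proof -
      have arc: "\<forall>t\<le>N. cuts_before t = k \<longrightarrow> kth_arc D k = arc_of D (p t)"
        using kth_arc[of k] k by simp
      obtain t where t: "t < N" "p t = under_top D (kth_crossing D k)" "cuts_before t = k"
        using kth[OF k arc] by blast
      then show ?thesis using arc[rule_format, of t] by (simp add: under_in_def)
    qed
    show "crossings D = kth_crossing D ` {..<m}"
    proof (intro equalityI subsetI)
      fix c assume c: "c \<in> crossings D"
      then obtain t where t: "t < N" "p t = under_top D c"
        using under_next_point[OF D, of c] unfolding S by auto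
      let ?k = "cuts_before t"
      have "Suc ?k = cuts_before (Suc t)" using t c by (simp add: cut)
      also have "\<dots> \<le> m" unfolding m_def using t by (intro cuts_before_mono) simp
      finally have k: "?k < m" by simp
      obtain s d where sd: "s < N" "d \<in> crossings D" "p s = under_top D d" "cuts_before s = ?k"
        "kth_crossing D ?k = d"
        using kth[OF k kth_arc] k by auto
      then have "s = t" using cut_eqI[of s t] t c by (simp add: cut)
      then have "c = d" using sd t inj_under_top by metis
      with k sd show "c \<in> kth_crossing D ` {..<m}" by auto
    next
      fix c assume "c \<in> kth_crossing D ` {..<m}"
      then obtain k where k: "k < m" "c = kth_crossing D k" by blast
      then show "c \<in> crossings D" using kth[OF k(1) kth_arc[of k]] by auto
    qed
  qed (rule bij)
qed


section \<open>Evaluation of colourings\<close>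

definition group_prod :: "('a, 'm) monoid_scheme \<Rightarrow> 'a list \<Rightarrow> 'a" where
  "group_prod H xs = foldr (mult H) xs \<one>\<^bsub>H\<^esub>"

lemma group_prod_simps [simp]:
  "group_prod H [] = \<one>\<^bsub>H\<^esub>" "group_prod H (a # as) = a \<otimes>\<^bsub>H\<^esub> group_prod H as"
  by (simp_all add: group_prod_def)

text \<open>Upward strands count inversely, so that the product of this list is the object of the
  category on that part of the horizontal line.\<close>

definition strand_colours ::
  "('h, 'e) xmod \<Rightarrow> diagram \<Rightarrow> (arc \<Rightarrow> 'h) \<Rightarrow> nat \<Rightarrow> nat \<Rightarrow> orient list \<Rightarrow> 'h list" where
  "strand_colours M D F i k os =
    map (\<lambda>j. signed M (os ! j) (F (arc_of D (i, k + j)))) [0..<length os]"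

lemma strand_colours_Nil [simp]: "strand_colours M D F i k [] = []"
  by (simp add: strand_colours_def)

lemma strand_colours_Cons [simp]:
  "strand_colours M D F i k (a # os) =
    signed M a (F (arc_of D (i, k))) # strand_colours M D F i (Suc k) os"
  by (simp add: strand_colours_def upt_conv_Cons map_Suc_upt[symmetric] del: upt_Suc)

lemma strand_colours_append:
  "strand_colours M D F i k (os @ os') =
    strand_colours M D F i k os @ strand_colours M D F i (k + length os) os'"
  by (induction os arbitrary: k) auto

lemma strand_colours_eqI:
  "(\<And>j. j < length os \<Longrightarrow> arc_of D (i, k + j) = arc_of D (i', k' + j)) \<Longrightarrow>
    strand_colours M D F i k os = strand_colours M D F i' k' os"
  by (simp add: strand_colours_def)

lemma map_fst_strand_mors:
  "map fst (strand_mors M D FC i k os) = strand_colours M D (fst FC) i k os"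
  by (simp add: strand_mors_def strand_colours_def id_mor_def)

lemma arc_of_eq:
  assumes "i < length D" "(p, q) \<in> joins i (D ! i)"
  shows "arc_of D p = arc_of D q"
proof -
  have "(p, q) \<in> arc_rel D"
    using assms unfolding arc_rel_def arc_joins_def by blast
  then show ?thesis unfolding arc_of_def by (rule equiv_class_eq[OF equiv_arc_rel_UNIV])
qed

lemma arc_of_left:
  assumes "i < length D" "k < length (lefts (D ! i))"
  shows "arc_of D (Suc i, k) = arc_of D (i, k)"
  using assms by (intro arc_of_eq[symmetric]) (auto simp: joins_def Let_def)

lemma arc_of_right:
  assumes "i < length D" "k < length (rights (D ! i))"
  shows "arc_of D (Suc i, length (lefts (D ! i)) + length (piece_bot (mid (D ! i))) + k) =
    arc_of D (i, length (lefts (D ! i)) + length (piece_top (mid (D ! i))) + k)"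
  using assms by (intro arc_of_eq[symmetric]) (auto simp: joins_def Let_def)

text \<open>This asks only that the crossing colour be a morphism from the product of the upper
  colours to that of the lower ones, whatever rule chose it. It covers the colourings of a
  Reidemeister pair as well as Wirtinger colourings with trivial crossing colours.\<close>

definition crossing_compatible :: "'a monoid \<Rightarrow> diagram \<Rightarrow> ('a, 'a) colouring \<Rightarrow> nat \<Rightarrow> bool" where
  "crossing_compatible H D FC c \<longleftrightarrow> snd FC c \<in> carrier H \<and>
    (let x = fst FC (over_arc D c); y = fst FC (under_out D c); z = fst FC (under_in D c) in
      if positive D c then snd FC c \<otimes>\<^bsub>H\<^esub> (z \<otimes>\<^bsub>H\<^esub> x) = x \<otimes>\<^bsub>H\<^esub> y
      else snd FC c \<otimes>\<^bsub>H\<^esub> (x \<otimes>\<^bsub>H\<^esub> z) = y \<otimes>\<^bsub>H\<^esub> x)"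

section \<open>Sources and targets of pieces, strips and evaluations\<close>

locale id_xmod_category = group H for H :: "'a monoid" (structure)
begin

abbreviation M where "M \<equiv> id_xmod H"

abbreviation mors where "mors \<equiv> carrier H \<times> carrier H"

lemma id_xmod_simps [simp]: "Hgrp M = H" "Egrp M = H" "bd M = id"
  by (simp_all add: id_xmod_def)

lemma group_prod_closed [simp]: "set as \<subseteq> carrier H \<Longrightarrow> group_prod H as \<in> carrier H"
  by (induction as) auto

lemma group_prod_append:
  "set as \<subseteq> carrier H \<Longrightarrow> set bs \<subseteq> carrier H \<Longrightarrow>
    group_prod H (as @ bs) = group_prod H as \<otimes> group_prod H bs"
  by (induction as) (auto simp: m_assoc)

text \<open>Conjugating the second label by the target of the first makes targets multiply just as
  sources do. The clauses on trivial labels, here and below, serve the closing Wirtinger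
  relation.\<close>

lemma tensor_mor:
  assumes "m \<in> mors" "m' \<in> mors"
  shows "tensor_mor M m m' \<in> mors" "fst (tensor_mor M m m') = fst m \<otimes> fst m'"
    "tgt M (tensor_mor M m m') = tgt M m \<otimes> tgt M m'"
    "snd m = \<one> \<Longrightarrow> snd m' = \<one> \<Longrightarrow> snd (tensor_mor M m m') = \<one>"
  using assms by (auto simp: tensor_mor_def tgt_def id_xmod_def word_simps)

lemma tensor_list:
  assumes "set ms \<subseteq> mors"
  shows "tensor_list M ms \<in> mors" "fst (tensor_list M ms) = group_prod H (map fst ms)"
    "tgt M (tensor_list M ms) = group_prod H (map (tgt M) ms)"
    "snd ` set ms \<subseteq> {\<one>} \<Longrightarrow> snd (tensor_list M ms) = \<one>"
proof -
  have "tensor_list M ms \<in> mors \<and> fst (tensor_list M ms) = group_prod H (map fst ms) \<and>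
    tgt M (tensor_list M ms) = group_prod H (map (tgt M) ms) \<and>
    (snd ` set ms \<subseteq> {\<one>} \<longrightarrow> snd (tensor_list M ms) = \<one>)"
    using assms
  proof (induction ms)
    case Nil
    show ?case by (simp add: tensor_list_def id_mor_def tgt_def)
  next
    case (Cons m ms)
    have eq: "tensor_list M (m # ms) = tensor_mor M m (tensor_list M ms)"
      by (simp add: tensor_list_def)
    from Cons tensor_mor[of m "tensor_list M ms"] show ?case
      unfolding eq by (simp del: mem_Sigma_iff)
  qed
  then show "tensor_list M ms \<in> mors" "fst (tensor_list M ms) = group_prod H (map fst ms)"
    "tgt M (tensor_list M ms) = group_prod H (map (tgt M) ms)"
    "snd ` set ms \<subseteq> {\<one>} \<Longrightarrow> snd (tensor_list M ms) = \<one>"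
    by blast+
qed

context
  fixes D and FC :: "('a, 'a) colouring"
  assumes D: "tangle_diagram [Dn] D [Dn]"
    and F: "fst FC \<in> arcs D \<rightarrow> carrier H"
    and C: "\<And>c. c \<in> crossings D \<Longrightarrow> crossing_compatible H D FC c"
begin

abbreviation cols where "cols \<equiv> strand_colours M D (fst FC)"

definition level_prod :: "nat \<Rightarrow> 'a" where
  "level_prod i = group_prod H (cols i 0 (level D i))"

lemma colour_closed:
  assumes "i \<le> length D" "k < length (level D i)"
  shows "fst FC (arc_of D (i, k)) \<in> carrier H"
proof -
  have "arc_of D (i, k) \<in> arcs D"
    using assms unfolding arcs_def arc_of_def by (intro quotientI) (simp add: points_def)
  then show ?thesis using F by blast
qed

lemma signed_closed: "a \<in> carrier H \<Longrightarrow> signed M s a \<in> carrier H"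
  by (cases s) auto

lemma strand_colours_closed:
  assumes "i \<le> length D" "k + length os \<le> length (level D i)"
  shows "set (cols i k os) \<subseteq> carrier H"
  using assms by (auto simp: strand_colours_def intro!: signed_closed colour_closed)

lemma strand_mors:
  assumes "i \<le> length D" "k + length os \<le> length (level D i)"
  shows "set (strand_mors M D FC i k os) \<subseteq> mors"
    "map (tgt M) (strand_mors M D FC i k os) = cols i k os"
    "snd ` set (strand_mors M D FC i k os) \<subseteq> {\<one>}"
  using assms
  by (auto simp: strand_mors_def strand_colours_def id_mor_def tgt_def
      intro!: l_one signed_closed colour_closed)

text \<open>At a crossing the claim on targets is compatibility; at a cup or cap the product of the
  two colours is trivial because both ends lie on one arc with opposite orientations.\<close>

lemma piece_mors:
  assumes i: "i < length D"
  defines "l \<equiv> length (lefts (D ! i))"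
  shows "set (piece_mors M D FC i) \<subseteq> mors"
    "group_prod H (map fst (piece_mors M D FC i)) = group_prod H (cols i l (piece_top (mid (D ! i))))"
    "group_prod H (map (tgt M) (piece_mors M D FC i)) =
      group_prod H (cols (Suc i) l (piece_bot (mid (D ! i))))"
proof -
  note lev = level_eq_strip_top[OF D i] level_Suc[of D i]
  have top: "fst FC (arc_of D (i, l + k)) \<in> carrier H" if "k < length (piece_top (mid (D ! i)))" for k
    using i that by (intro colour_closed) (auto simp: lev strip_top_def l_def)
  have bot: "fst FC (arc_of D (Suc i, l + k)) \<in> carrier H" if "k < length (piece_bot (mid (D ! i)))" for k
    using i that by (intro colour_closed) (auto simp: lev strip_bot_def l_def)
  have "set (piece_mors M D FC i) \<subseteq> mors \<and>
    group_prod H (map fst (piece_mors M D FC i)) = group_prod H (cols i l (piece_top (mid (D ! i)))) \<and>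
    group_prod H (map (tgt M) (piece_mors M D FC i)) =
      group_prod H (cols (Suc i) l (piece_bot (mid (D ! i))))"
  proof (cases "mid (D ! i)" rule: piece_top.cases)
    case 1
    then have "crossing_compatible H D FC i" using i by (intro C) (simp add: crossings_def)
    \<comment> \<open>The over-strand leaves a positive crossing at the bottom left, still on the
      arc by which it entered.\<close>
    moreover have "arc_of D (Suc i, l) = over_arc D i"
      unfolding over_arc_def
      using 1 by (intro arc_of_eq[OF i, symmetric]) (simp add: over_top_def positive_def joins_def l_def Let_def)
    ultimately show ?thesis
      using 1 top[of 0] top[of 1] bot[of 0] bot[of 1]
      by (simp add: crossing_compatible_def piece_mors_def positive_def tgt_def under_in_def
          under_top_def under_out_def under_bot_def over_arc_def over_top_def Let_def flip: l_def)
  next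
    case 2
    then have "crossing_compatible H D FC i" using i by (intro C) (simp add: crossings_def)
    moreover have "arc_of D (Suc i, Suc l) = over_arc D i"
      unfolding over_arc_def
      using 2 by (intro arc_of_eq[OF i, symmetric]) (simp add: over_top_def positive_def joins_def l_def Let_def)
    ultimately show ?thesis
      using 2 top[of 0] top[of 1] bot[of 0] bot[of 1]
      by (simp add: crossing_compatible_def piece_mors_def positive_def tgt_def under_in_def
          under_top_def under_out_def under_bot_def over_arc_def over_top_def Let_def flip: l_def)
  next
    case (3 a)
    then have "arc_of D (i, Suc l) = arc_of D (i, l)"
      by (intro arc_of_eq[OF i, symmetric]) (simp add: joins_def l_def Let_def)
    then show ?thesis
      using 3 top[of 0] by (cases a) (simp_all add: piece_mors_def tgt_def flip: l_def)
  next
    case (4 a)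
    then have "arc_of D (Suc i, Suc l) = arc_of D (Suc i, l)"
      by (intro arc_of_eq[OF i, symmetric]) (simp add: joins_def l_def Let_def)
    then show ?thesis
      using 4 bot[of 0] by (cases a) (simp_all add: piece_mors_def tgt_def flip: l_def)
  next
    case 5
    then show ?thesis by (simp add: piece_mors_def)
  qed
  then show "set (piece_mors M D FC i) \<subseteq> mors"
    "group_prod H (map fst (piece_mors M D FC i)) = group_prod H (cols i l (piece_top (mid (D ! i))))"
    "group_prod H (map (tgt M) (piece_mors M D FC i)) =
      group_prod H (cols (Suc i) l (piece_bot (mid (D ! i))))"
    by blast+
qed

lemma strip_mor:
  assumes i: "i < length D"
  shows "strip_mor M D FC i \<in> mors" "fst (strip_mor M D FC i) = level_prod i"
    "tgt M (strip_mor M D FC i) = level_prod (Suc i)"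
    "snd ` set (piece_mors M D FC i) \<subseteq> {\<one>} \<Longrightarrow> snd (strip_mor M D FC i) = \<one>"
proof -
  define l where "l = length (lefts (D ! i))"
  define a where "a = length (piece_top (mid (D ! i)))"
  define b where "b = length (piece_bot (mid (D ! i)))"
  let ?ls = "lefts (D ! i)" and ?rs = "rights (D ! i)" and ?p = "piece_mors M D FC i"
    and ?t = "piece_top (mid (D ! i))" and ?b = "piece_bot (mid (D ! i))"
  have lev: "level D i = ?ls @ ?t @ ?rs" "level D (Suc i) = ?ls @ ?b @ ?rs"
    using level_eq_strip_top[OF D i] level_Suc[of D i] by (simp_all add: strip_top_def strip_bot_def)
  have strip: "strip_mor M D FC i = tensor_list M
      (strand_mors M D FC i 0 ?ls @ ?p @ strand_mors M D FC i (l + a) ?rs)"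
    by (simp add: strip_mor_def Let_def l_def a_def)
  note L = strand_mors[of i 0 ?ls] and R = strand_mors[of i "l + a" ?rs] and P = piece_mors[OF i, folded l_def]
  have mors: "set (strand_mors M D FC i 0 ?ls @ ?p @ strand_mors M D FC i (l + a) ?rs) \<subseteq> mors"
    using L R P i by (simp add: lev l_def a_def)
  show "strip_mor M D FC i \<in> mors"
    unfolding strip by (rule tensor_list(1)[OF mors])
  show "snd (strip_mor M D FC i) = \<one>" if "snd ` set ?p \<subseteq> {\<one>}"
    unfolding strip using that L R i by (intro tensor_list(4)[OF mors]) (simp add: lev l_def a_def image_Un)
  have closed: "set (cols i 0 ?ls) \<subseteq> carrier H" "set (cols i l ?t) \<subseteq> carrier H"
    "set (cols (Suc i) l ?b) \<subseteq> carrier H" "set (cols i (l + a) ?rs) \<subseteq> carrier H"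
    using i by (intro strand_colours_closed; simp add: lev l_def a_def)+
  have closed_piece: "set (map fst ?p) \<subseteq> carrier H" "set (map (tgt M) ?p) \<subseteq> carrier H"
    using P(1) by (fastforce simp: tgt_def)+
  show "fst (strip_mor M D FC i) = level_prod i"
    unfolding strip tensor_list(2)[OF mors] level_prod_def lev
    using closed closed_piece P(2)
    by (simp add: map_fst_strand_mors strand_colours_append group_prod_append flip: l_def a_def)
  have "cols (Suc i) 0 ?ls = cols i 0 ?ls"
    by (intro strand_colours_eqI) (simp add: arc_of_left[OF i])
  moreover have "cols (Suc i) (l + b) ?rs = cols i (l + a) ?rs"
    unfolding l_def a_def b_def by (intro strand_colours_eqI arc_of_right[OF i])
  ultimately show "tgt M (strip_mor M D FC i) = level_prod (Suc i)"
    unfolding strip tensor_list(3)[OF mors] level_prod_def lev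
    using closed closed_piece P(3) L(2) R(2) i
    by (simp add: strand_colours_append group_prod_append lev flip: l_def a_def b_def)
qed

text \<open>Targets telescope: the composite of the first \<open>n\<close> strips ends at
  \<open>level_prod n\<close>, and the last level is the bottom strand alone.\<close>

lemma evaluation:
  shows "evaluation M D FC \<in> mors" "fst (evaluation M D FC) = fst FC (top_arc D)"
    "tgt M (evaluation M D FC) = fst FC (bot_arc D)"
    "(\<And>c. c \<in> crossings D \<Longrightarrow> snd FC c = \<one>) \<Longrightarrow> snd (evaluation M D FC) = \<one>"
proof -
  let ?e = "\<lambda>n. foldl (seq_mor M) (id_mor M (fst FC (top_arc D))) (map (strip_mor M D FC) [0..<n])"
  have top: "fst FC (top_arc D) \<in> carrier H"
    using colour_closed[of 0 0] by (simp add: top_arc_def level_def)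
  have "?e n \<in> mors \<and> fst (?e n) = fst FC (top_arc D) \<and> tgt M (?e n) = level_prod n \<and>
      ((\<forall>c\<in>crossings D. snd FC c = \<one>) \<longrightarrow> snd (?e n) = \<one>)" if "n \<le> length D" for n
    using that
  proof (induction n)
    case 0
    then show ?case using top by (simp add: id_mor_def tgt_def level_prod_def level_def top_arc_def)
  next
    case (Suc n)
    \<comment> \<open>Cups and caps always carry the unit, so crossing colours are the only labels
      to control.\<close>
    have "snd ` set (piece_mors M D FC n) \<subseteq> {\<one>}" if "\<forall>c\<in>crossings D. snd FC c = \<one>"
      using that Suc.prems
      by (cases "mid (D ! n)" rule: piece_top.cases) (simp_all add: piece_mors_def crossings_def Let_def)
    with strip_mor[of n] Suc show ?case
      by (auto simp: seq_mor_def tgt_def m_assoc)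
  qed
  from this[of "length D"] show "evaluation M D FC \<in> mors" "fst (evaluation M D FC) = fst FC (top_arc D)"
    "tgt M (evaluation M D FC) = fst FC (bot_arc D)"
    "(\<And>c. c \<in> crossings D \<Longrightarrow> snd FC c = \<one>) \<Longrightarrow> snd (evaluation M D FC) = \<one>"
    using colour_closed[of "length D" 0]
    by (simp_all add: evaluation_def level_prod_def level_last[OF D] bot_arc_def)
qed

end

end


section \<open>Colourings and homomorphisms\<close>

lemma sum_single_const: "(\<Sum>a\<in>A. Poly_Mapping.single k (1 :: nat)) = Poly_Mapping.single k (card A)"
  by (induction A rule: infinite_finite_induct) (simp_all flip: single_add)

lemma lookup_sum_single:
  assumes "finite A"
  shows "Poly_Mapping.lookup (\<Sum>a\<in>A. Poly_Mapping.single (f a) (1 :: nat)) k = card {a \<in> A. f a = k}"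
proof -
  have "Poly_Mapping.lookup (\<Sum>a\<in>A. Poly_Mapping.single (f a) (1 :: nat)) k =
      (\<Sum>a\<in>A. if f a = k then 1 else 0)"
    by (simp only: lookup_sum lookup_single when_def)
  then show ?thesis using assms by (simp add: sum.If_cases Int_def)
qed

lemma (in id_xmod_category) Hom_one:
  assumes "g \<in> carrier H"
  shows "Hom M \<one> g = {(\<one>, g)}"
  using assms by (auto simp: Hom_def)

lemma (in id_xmod_category) crossing_compatible_colouring:
  assumes e: "snd FC c \<in> carrier H"
    and F: "fst FC (over_arc D c) \<in> carrier H" "fst FC (under_out D c) \<in> carrier H"
    and z: "fst FC (under_in D c) = (if positive D c
      then under_pos M (snd FC c) (fst FC (over_arc D c)) (fst FC (under_out D c))
      else under_neg M (snd FC c) (fst FC (over_arc D c)) (fst FC (under_out D c)))"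
  shows "crossing_compatible H D FC c"
  using e F
  by (simp add: crossing_compatible_def z under_pos_def under_neg_def Let_def word_simps)

text \<open>The assumptions after the first are the conclusion of \<open>string_knot_arcs\<close>;
  connectedness of the knot enters from here on only through them.\<close>

locale string_knot = eisermann +
  fixes D m
  assumes D: "tangle_diagram [Dn] D [Dn]"
    and num_arcs: "num_arcs D = Suc m"
    and bij_arcs: "bij_betw (kth_arc D) {..m} (arcs D)"
    and last_arc: "kth_arc D m = bot_arc D"
    and crossings: "crossings D = kth_crossing D ` {..<m}"
    and under_in: "\<And>k. k < m \<Longrightarrow> under_in D (kth_crossing D k) = kth_arc D k"
begin

abbreviation "N \<equiv> derived G (carrier G)"
abbreviation "M \<equiv> id_xmod (derived_group G)"
abbreviation "arc \<equiv> kth_arc D"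
abbreviation "over k \<equiv> over_arc D (kth_crossing D k)"
abbreviation "sign k \<equiv> positive D (kth_crossing D k)"

definition signed_pow :: "bool \<Rightarrow> 'a \<Rightarrow> 'a" where
  "signed_pow b u = (if b then u else inv u)"

lemma signed_pow_closed [simp]: "u \<in> carrier G \<Longrightarrow> signed_pow b u \<in> carrier G"
  by (simp add: signed_pow_def)

lemma arc_in_arcs: "k \<le> m \<Longrightarrow> arc k \<in> arcs D"
  using bij_arcs by (auto simp: bij_betw_def)

lemma over_in_arcs:
  assumes "k < m"
  shows "over k \<in> arcs D"
proof -
  have "kth_crossing D k \<in> crossings D" using crossings assms by auto
  then have "over_top D (kth_crossing D k) \<in> points D"
    using level_eq_strip_top[OF D, of "kth_crossing D k"]
    by (auto simp: over_top_def points_def crossings_def strip_top_def Let_def)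
  then show ?thesis unfolding over_arc_def arc_of_def arcs_def by (rule quotientI)
qed

lemma under_out: "under_out D (kth_crossing D k) = arc (Suc k)"
  by (simp add: kth_crossing_def)

lemma finite_arcs: "finite (arcs D)"
  using bij_betw_finite[OF bij_arcs] by simp

lemma top_arc: "top_arc D = arc 0"
  by simp

section \<open>Homomorphisms as Wirtinger colourings, and the partial products of the
  longitude\<close>

definition longitude_word :: "nat \<Rightarrow> arc word" where
  "longitude_word k = concat (map (\<lambda>k. [(arc k, \<not> sign k), (over k, sign k)]) [0..<k])"

lemma longitude_word_in_words: "k \<le> m \<Longrightarrow> longitude_word k \<in> words (arcs D)"
  unfolding longitude_word_def using arc_in_arcs over_in_arcs by auto

definition partial_longitude :: "(arc \<Rightarrow> 'a) \<Rightarrow> nat \<Rightarrow> 'a" where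
  "partial_longitude h k = eval_word G h (longitude_word k)"

lemma partial_longitude_0 [simp]: "partial_longitude h 0 = \<one>"
  by (simp add: partial_longitude_def longitude_word_def)

lemma partial_longitude_Suc:
  assumes h: "h \<in> arcs D \<rightarrow> carrier G" and k: "k < m"
  shows "partial_longitude h (Suc k) =
    partial_longitude h k \<otimes> (signed_pow (\<not> sign k) (h (arc k)) \<otimes> signed_pow (sign k) (h (over k)))"
proof -
  have "longitude_word (Suc k) = longitude_word k @ [(arc k, \<not> sign k), (over k, sign k)]"
    by (simp add: longitude_word_def)
  moreover have "longitude_word k \<in> words (arcs D)" using k by (intro longitude_word_in_words) simp
  moreover have "h (arc k) \<in> carrier G" "h (over k) \<in> carrier G"
    using h arc_in_arcs[of k] over_in_arcs[OF k] k by auto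
  ultimately show ?thesis
    using eval_word_append[OF h, of "longitude_word k" "[(arc k, \<not> sign k), (over k, sign k)]"]
      arc_in_arcs[of k] over_in_arcs[OF k] k
    by (simp add: partial_longitude_def signed_pow_def)
qed

lemma wirtinger_words: "wirtinger_relations D \<subseteq> words (arcs D) \<times> words (arcs D)"
  using arc_in_arcs over_in_arcs by (auto simp: wirtinger_relations_def num_arcs simp del: kth_arc.simps)

text \<open>The closing relation is absent from this definition; \<open>wirtinger_compatible\<close>
  derives it.\<close>

definition wirtinger_colourings :: "(arc \<Rightarrow> 'a) set" where
  "wirtinger_colourings = {h \<in> arcs D \<rightarrow>\<^sub>E carrier G. h (arc 0) = x \<and>
    (\<forall>k<m. h (arc (Suc k)) =
      signed_pow (\<not> sign k) (h (over k)) \<otimes> h (arc k) \<otimes> signed_pow (sign k) (h (over k)))}"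

lemma wirtinger_compatible:
  assumes h: "h \<in> wirtinger_colourings"
  shows "h (bot_arc D) = h (top_arc D)"
proof -
  \<comment> \<open>With every crossing coloured trivially, the Wirtinger relations say that a crossing preserves
    the product of the colours across it.\<close>
  interpret C: id_xmod_category G by unfold_locales
  have hG: "h \<in> arcs D \<rightarrow> carrier G" using h by (auto simp: wirtinger_colourings_def)
  have "crossing_compatible G D (h, \<lambda>_. \<one>) c" if c: "c \<in> crossings D" for c
  proof -
    obtain k where k: "k < m" "c = kth_crossing D k" using c crossings by auto
    have "h (arc k) \<in> carrier G" "h (over k) \<in> carrier G"
      using hG arc_in_arcs[of k] over_in_arcs[of k] k by auto
    moreover have "h (arc (Suc k)) =
        signed_pow (\<not> sign k) (h (over k)) \<otimes> h (arc k) \<otimes> signed_pow (sign k) (h (over k))"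
      using h k by (simp add: wirtinger_colourings_def del: kth_arc.simps)
    ultimately show ?thesis
      by (simp add: crossing_compatible_def k under_in under_out signed_pow_def Let_def word_simps
          del: kth_arc.simps)
  qed
  note ev = C.evaluation[OF D, of "(h, \<lambda>_. \<one>)", simplified, OF hG this]
  have "h (top_arc D) \<in> carrier G" using hG arc_in_arcs[of 0] by auto
  \<comment> \<open>With trivial labels the evaluation is an identity, so its source and target, the
    colours of the two end-points, coincide.\<close>
  then show ?thesis using ev(2-4) by (simp add: tgt_def)
qed

lemma solutions_eq:
  "{h \<in> solutions G (arcs D) (wirtinger_relations D). h (arc 0) = x} = wirtinger_colourings"
proof -
  have iff: "h \<in> solutions G (arcs D) (wirtinger_relations D) \<longleftrightarrow>
      (\<forall>k<m. h (arc (Suc k)) =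
        signed_pow (\<not> sign k) (h (over k)) \<otimes> h (arc k) \<otimes> signed_pow (sign k) (h (over k))) \<and>
      h (arc m) = h (arc 0)" if h: "h \<in> arcs D \<rightarrow>\<^sub>E carrier G" for h
  proof -
    have c: "h (arc k) \<in> carrier G" if "k \<le> m" for k using h arc_in_arcs[OF that] by auto
    have o: "h (over k) \<in> carrier G" if "k < m" for k using h over_in_arcs[OF that] by auto
    have "(eval_word G h [(arc (Suc k), True)] =
        eval_word G h [(over k, \<not> sign k), (arc k, True), (over k, sign k)]) \<longleftrightarrow>
      h (arc (Suc k)) =
        signed_pow (\<not> sign k) (h (over k)) \<otimes> h (arc k) \<otimes> signed_pow (sign k) (h (over k))"
      if "k < m" for k
      using c[of k] c[of "Suc k"] o[of k] that
      by (simp add: signed_pow_def m_assoc del: kth_arc.simps)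
    moreover have "(eval_word G h [(arc m, True)] = eval_word G h [(arc 0, True)]) \<longleftrightarrow>
        h (arc m) = h (arc 0)"
      using c[of m] c[of 0] by (simp del: kth_arc.simps)
    moreover have "h \<in> solutions G (arcs D) (wirtinger_relations D) \<longleftrightarrow>
      (\<forall>k<m. eval_word G h [(arc (Suc k), True)] =
        eval_word G h [(over k, \<not> sign k), (arc k, True), (over k, sign k)]) \<and>
      eval_word G h [(arc m, True)] = eval_word G h [(arc 0, True)]"
      using h unfolding solutions_def wirtinger_relations_def num_arcs diff_Suc_1
      by (auto simp del: kth_arc.simps eval_word_simps)
    ultimately show ?thesis by blast
  qed
  show ?thesis
  proof (intro equalityI subsetI)
    fix h assume "h \<in> {h \<in> solutions G (arcs D) (wirtinger_relations D). h (arc 0) = x}"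
    then have "h \<in> solutions G (arcs D) (wirtinger_relations D)" "h (arc 0) = x"
      "h \<in> arcs D \<rightarrow>\<^sub>E carrier G" by (simp_all add: solutions_def)
    then show "h \<in> wirtinger_colourings"
      using iff[of h] by (simp add: wirtinger_colourings_def del: kth_arc.simps)
  next
    fix h assume h: "h \<in> wirtinger_colourings"
    then have "h (arc m) = h (arc 0)" using wirtinger_compatible[OF h] by (simp add: last_arc)
    then show "h \<in> {h \<in> solutions G (arcs D) (wirtinger_relations D). h (arc 0) = x}"
      using h iff[of h] by (simp add: wirtinger_colourings_def del: kth_arc.simps)
  qed
qed

text \<open>Restriction to the generators turns the coefficient into a count of solutions: the
  meridian becomes the value on the first arc, and the longitude becomes the full product of its
  factors.\<close>

lemma eisermann_coeff_eq:
  assumes "finite (carrier G)"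
  shows "eisermann_coeff G x D g =
    card {h \<in> wirtinger_colourings. partial_longitude h m = g}"
proof -
  let ?S = "arcs D" and ?R = "wirtinger_relations D"
  let ?homs = "hom (knot_group D) G \<inter> extensional (carrier (knot_group D))"
  let ?r = "\<lambda>f. \<lambda>s\<in>?S. f (word_class ?S ?R [(s, True)])"
  have bij: "bij_betw ?r ?homs (solutions G ?S ?R)"
    unfolding knot_group_def by (rule bij_betw_hom_solutions[OF wirtinger_words])
  \<comment> \<open>Finiteness of \<open>G\<close> and of the set of arcs bounds the number of
    homomorphisms; a sum over an infinite set would be 0 by convention.\<close>
  have "finite (solutions G ?S ?R)"
    by (rule finite_subset[OF _ finite_PiE[OF finite_arcs assms]]) (auto simp: solutions_def)
  then have "finite ?homs" using bij_betw_finite[OF bij] by simp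
  then have fin: "finite {f \<in> ?homs. f (meridian D) = x}" by (rule rev_finite_subset) blast
  have mer: "f (meridian D) = ?r f (arc 0)" for f
    using arc_in_arcs[of 0] by (simp add: meridian_def del: kth_arc.simps)
  have lon: "f (longitude D) = partial_longitude (?r f) m" if "f \<in> ?homs" for f
    using that hom_eq_eval_word[OF wirtinger_words _ longitude_word_in_words, of f m]
    by (simp add: longitude_def partial_longitude_def longitude_word_def num_arcs Let_def knot_group_def)
  have "eisermann_coeff G x D g = card {f \<in> {f \<in> ?homs. f (meridian D) = x}. f (longitude D) = g}"
    unfolding eisermann_coeff_def eisermann_invariant_def
    using lookup_sum_single[OF fin, of "\<lambda>f. f (longitude D)" g] by (simp add: conj_assoc)
  also have "{f \<in> {f \<in> ?homs. f (meridian D) = x}. f (longitude D) = g} =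
      {f \<in> ?homs. ?r f (arc 0) = x \<and> partial_longitude (?r f) m = g}"
  proof (intro Collect_cong)
    fix f
    show "(f \<in> {f \<in> ?homs. f (meridian D) = x} \<and> f (longitude D) = g) =
      (f \<in> ?homs \<and> ?r f (arc 0) = x \<and> partial_longitude (?r f) m = g)"
    proof (cases "f \<in> ?homs")
      case True
      then show ?thesis unfolding mer[of f, symmetric] lon[OF True, symmetric] by simp
    qed (simp only: mem_Collect_eq simp_thms)
  qed
  also have "card \<dots> = card {h \<in> solutions G ?S ?R. h (arc 0) = x \<and> partial_longitude h m = g}"
    by (rule bij_betw_same_card[OF bij_betw_Collect[OF bij]]) (rule HOL.refl)
  also have "{h \<in> solutions G ?S ?R. h (arc 0) = x \<and> partial_longitude h m = g} =
      {h \<in> wirtinger_colourings. partial_longitude h m = g}"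
    unfolding solutions_eq[symmetric] by auto
  finally show ?thesis .
qed

section \<open>The correspondence between arc colourings in \<open>N\<close> and Wirtinger
  colourings\<close>

definition arc_colourings :: "(arc \<Rightarrow> 'a) set" where
  "arc_colourings = {F \<in> arcs D \<rightarrow>\<^sub>E N. F (arc 0) = \<one> \<and> (\<forall>k<m. F (arc (Suc k)) =
    signed_pow (\<not> sign k) x \<otimes> F (arc k) \<otimes> inv (F (over k)) \<otimes> signed_pow (sign k) x \<otimes> F (over k))}"

definition conjugate_colouring :: "(arc \<Rightarrow> 'a) \<Rightarrow> arc \<Rightarrow> 'a" where
  "conjugate_colouring F = (\<lambda>a\<in>arcs D. inv (F a) \<otimes> x \<otimes> F a)"

lemma signed_pow_conjugate:
  "u \<in> carrier G \<Longrightarrow> v \<in> carrier G \<Longrightarrow>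
    signed_pow b (inv u \<otimes> (v \<otimes> u)) = inv u \<otimes> (signed_pow b v \<otimes> u)"
  by (simp add: signed_pow_def word_simps)

text \<open>Write F_k for the colour of the \<open>k\<close>-th arc, F_o for that of the over-arc
  and e for the sign. The recursion reads F_(k+1) = x^(-e) F_k (F_o^(-1) x^e F_o). In the conjugate
  of x by F_(k+1) the factor x^(-e) drops out, which leaves the Wirtinger relation. Moreover x^(-e)
  F_k is F_k times the conjugate F_k^(-1) x^(-e) F_k, so F_(k+1) is F_k times the next factor of the
  longitude.\<close>

lemma conjugate_colouring:
  assumes F: "F \<in> arc_colourings"
  shows "conjugate_colouring F \<in> wirtinger_colourings"
    "k \<le> m \<Longrightarrow> partial_longitude (conjugate_colouring F) k = F (arc k)"
proof -
  let ?h = "conjugate_colouring F"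
  have FG: "F a \<in> carrier G" if "a \<in> arcs D" for a
    using F that by (intro derived_in_carrier) (auto simp: arc_colourings_def)
  have h: "?h a = inv (F a) \<otimes> x \<otimes> F a" if "a \<in> arcs D" for a
    using that by (simp add: conjugate_colouring_def)
  have hG: "?h \<in> arcs D \<rightarrow> carrier G" using FG x by (auto simp: h)
  have step: "F (arc (Suc k)) =
    signed_pow (\<not> sign k) x \<otimes> F (arc k) \<otimes> inv (F (over k)) \<otimes> signed_pow (sign k) x \<otimes> F (over k)"
    if "k < m" for k using F that by (simp add: arc_colourings_def del: kth_arc.simps)
  have F0: "F (arc 0) = \<one>" using F by (simp add: arc_colourings_def)
  have "?h (arc (Suc k)) =
      signed_pow (\<not> sign k) (?h (over k)) \<otimes> ?h (arc k) \<otimes> signed_pow (sign k) (?h (over k))"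
    if k: "k < m" for k
  proof -
    note a = arc_in_arcs[of k] arc_in_arcs[of "Suc k"] over_in_arcs[OF k]
    show ?thesis
      using k a FG x
      by (simp add: h step signed_pow_def word_simps del: kth_arc.simps)
  qed
  moreover have "?h (arc 0) = x" using arc_in_arcs[of 0] x by (simp add: h F0 del: kth_arc.simps)
  moreover have "?h \<in> arcs D \<rightarrow>\<^sub>E carrier G" using hG by (simp add: PiE_def) (simp add: conjugate_colouring_def)
  ultimately show "?h \<in> wirtinger_colourings" by (simp add: wirtinger_colourings_def del: kth_arc.simps)
  show "partial_longitude ?h k = F (arc k)" if "k \<le> m"
    using that
  proof (induction k)
    case 0
    then show ?case by (simp add: F0 del: kth_arc.simps)
  next
    case (Suc k)
    then have k: "k < m" by simp
    note a = arc_in_arcs[of k] over_in_arcs[OF k]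
    show ?case
      using Suc a FG x
      by (simp add: partial_longitude_Suc[OF hG k] h step[OF k] signed_pow_conjugate word_simps
          del: kth_arc.simps)
  qed
qed

text \<open>The first factor is the conjugate of \<open>inv ?p\<close> by
  \<open>inv u \<otimes> v\<close>, so the product is a commutator.\<close>

lemma conjugates_quotient_in_derived:
  assumes "u \<in> carrier G" "v \<in> carrier G"
  shows "signed_pow (\<not> b) (inv u \<otimes> x \<otimes> u) \<otimes> signed_pow b (inv v \<otimes> x \<otimes> v) \<in> N"
proof -
  let ?w = "inv v \<otimes> u" and ?p = "signed_pow b (inv v \<otimes> x \<otimes> v)"
  have "signed_pow (\<not> b) (inv u \<otimes> x \<otimes> u) \<otimes> ?p = commutator G (inv u \<otimes> v) (inv ?p)"
    using assms x
    by (cases b) (simp_all add: signed_pow_def commutator_def word_simps)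
  then show ?thesis using assms x by (simp add: commutator_in_derived)
qed

lemma conjugate_colouring_surj:
  assumes h: "h \<in> wirtinger_colourings"
  shows "\<exists>F\<in>arc_colourings. h = conjugate_colouring F"
proof -
  \<comment> \<open>\<open>the_inv_into\<close> gives the number of an arc along the knot, so
    \<open>F\<close> is the partial longitude reached at that arc.\<close>
  define F where "F = (\<lambda>a\<in>arcs D. partial_longitude h (the_inv_into {..m} arc a))"
  have hG: "h \<in> arcs D \<rightarrow> carrier G" and h0: "h (arc 0) = x"
    and step: "\<And>k. k < m \<Longrightarrow> h (arc (Suc k)) =
      signed_pow (\<not> sign k) (h (over k)) \<otimes> h (arc k) \<otimes> signed_pow (sign k) (h (over k))"
    using h by (auto simp: wirtinger_colourings_def simp del: kth_arc.simps)
  have F_arc: "F (arc k) = partial_longitude h k" if "k \<le> m" for k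
    using that bij_arcs arc_in_arcs[OF that]
    by (simp add: F_def bij_betw_def the_inv_into_f_f del: kth_arc.simps)
  have ex_arc: "\<exists>k\<le>m. a = arc k" if "a \<in> arcs D" for a
    using that bij_arcs by (auto simp: bij_betw_def image_iff simp del: kth_arc.simps)
  have lG: "partial_longitude h k \<in> carrier G" if "k \<le> m" for k
    unfolding partial_longitude_def by (intro eval_word_closed[OF hG] longitude_word_in_words that)
  \<comment> \<open>Passing from \<open>k\<close> to \<open>Suc k\<close> conjugates by the new
    factor of the longitude. Its first part is a power of \<open>h (arc k)\<close> and fixes
    \<open>h (arc k)\<close>; its second part produces the Wirtinger relation.\<close>
  have conj: "h (arc k) = inv (partial_longitude h k) \<otimes> x \<otimes> partial_longitude h k" if "k \<le> m" for k
    using that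
  proof (induction k)
    case 0
    then show ?case using x by (simp add: h0 del: kth_arc.simps)
  next
    case (Suc k)
    then have k: "k < m" by simp
    have hk: "h (arc k) \<in> carrier G" "h (over k) \<in> carrier G"
      using hG arc_in_arcs[of k] over_in_arcs[OF k] k by auto
    have "inv (partial_longitude h (Suc k)) \<otimes> x \<otimes> partial_longitude h (Suc k) =
      inv (signed_pow (sign k) (h (over k))) \<otimes> inv (signed_pow (\<not> sign k) (h (arc k))) \<otimes>
      (inv (partial_longitude h k) \<otimes> x \<otimes> partial_longitude h k) \<otimes>
      signed_pow (\<not> sign k) (h (arc k)) \<otimes> signed_pow (sign k) (h (over k))"
      using lG[of k] hk k x by (simp add: partial_longitude_Suc[OF hG k] word_simps)
    also have "\<dots> = h (arc (Suc k))"
      unfolding step[OF k] using Suc hk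
      by (simp add: signed_pow_def word_simps flip: Suc.IH del: kth_arc.simps)
    finally show ?case by simp
  qed
  have h_conj: "\<exists>u\<in>carrier G. h a = inv u \<otimes> x \<otimes> u" if "a \<in> arcs D" for a
    using ex_arc[OF that] conj lG by blast
  have lN: "partial_longitude h k \<in> N" if "k \<le> m" for k
    using that
  proof (induction k)
    case 0
    then show ?case by (simp add: subgroup.one_closed[OF derived_subgroup])
  next
    case (Suc k)
    then have k: "k < m" by simp
    obtain u v where "u \<in> carrier G" "v \<in> carrier G" "h (arc k) = inv u \<otimes> x \<otimes> u"
      "h (over k) = inv v \<otimes> x \<otimes> v"
      using h_conj[OF arc_in_arcs[of k]] h_conj[OF over_in_arcs[OF k]] k by auto
    then have "signed_pow (\<not> sign k) (h (arc k)) \<otimes> signed_pow (sign k) (h (over k)) \<in> N"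
      using conjugates_quotient_in_derived by simp
    then show ?case
      using Suc k by (simp add: partial_longitude_Suc[OF hG k] subgroup.m_closed[OF derived_subgroup])
  qed
  have FN: "F a \<in> N" if "a \<in> arcs D" for a using ex_arc[OF that] F_arc lN by force
  have h_eq: "h a = inv (F a) \<otimes> x \<otimes> F a" if "a \<in> arcs D" for a
    using ex_arc[OF that] conj F_arc by force
  have "F (arc (Suc k)) =
      signed_pow (\<not> sign k) x \<otimes> F (arc k) \<otimes> inv (F (over k)) \<otimes> signed_pow (sign k) x \<otimes> F (over k)"
    if k: "k < m" for k
  proof -
    note a = arc_in_arcs[of k] over_in_arcs[OF k]
    note FG = a[THEN FN, THEN derived_in_carrier]
    have "F (arc (Suc k)) =
      F (arc k) \<otimes> (signed_pow (\<not> sign k) (h (arc k)) \<otimes> signed_pow (sign k) (h (over k)))"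
      using k by (simp add: F_arc partial_longitude_Suc[OF hG k] del: kth_arc.simps)
    then show ?thesis
      using k a FG x by (simp add: h_eq signed_pow_conjugate word_simps del: kth_arc.simps)
  qed
  moreover have "F (arc 0) = \<one>" by (simp add: F_arc del: kth_arc.simps)
  moreover have "F \<in> arcs D \<rightarrow>\<^sub>E N" using FN by (auto simp: F_def)
  ultimately have "F \<in> arc_colourings" by (simp add: arc_colourings_def del: kth_arc.simps)
  moreover have "h = conjugate_colouring F"
    using h h_eq by (intro extensionalityI[of _ "arcs D"])
      (auto simp: wirtinger_colourings_def conjugate_colouring_def PiE_iff)
  ultimately show ?thesis by blast
qed

text \<open>Injectivity holds because the partial longitudes of the image give back the colours of
  all arcs; the last of them is the image of the longitude, which matches the two conditions on
  \<open>g\<close>.\<close>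

lemma bij_conjugate_colouring:
  "bij_betw conjugate_colouring {F \<in> arc_colourings. F (arc m) = g}
    {h \<in> wirtinger_colourings. partial_longitude h m = g}"
proof (rule bij_betw_Collect)
  show "bij_betw conjugate_colouring arc_colourings wirtinger_colourings"
  proof (rule bij_betwI')
    fix F F' assume F: "F \<in> arc_colourings" and F': "F' \<in> arc_colourings"
    have "F = F'" if eq: "conjugate_colouring F = conjugate_colouring F'"
    proof (rule extensionalityI[of _ "arcs D"])
      fix a assume "a \<in> arcs D"
      then obtain k where "k \<le> m" "a = arc k" using bij_arcs by (auto simp: bij_betw_def)
      then show "F a = F' a"
        using conjugate_colouring(2)[OF F] conjugate_colouring(2)[OF F'] eq by metis
    qed (use F F' in \<open>auto simp: arc_colourings_def PiE_iff\<close>)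
    then show "(conjugate_colouring F = conjugate_colouring F') = (F = F')" by auto
  qed (use conjugate_colouring(1) conjugate_colouring_surj in blast)+
qed (simp add: conjugate_colouring(2))

text \<open>A colouring expresses the incoming under-arc by the outgoing one. Travelling along the
  knot requires the opposite, and the rules solved for \<open>h\<close> are the recursion in
  \<open>arc_colourings\<close>.\<close>

lemma under_eq_iff:
  assumes "g \<in> N" "h \<in> N" "z \<in> N"
  shows "z = under_neg M (eis_phi G x g h) g h \<longleftrightarrow> h = x \<otimes> z \<otimes> inv g \<otimes> inv x \<otimes> g"
    and "z = under_pos M (eis_psi G x g h) g h \<longleftrightarrow> h = inv x \<otimes> z \<otimes> inv g \<otimes> x \<otimes> g"
  unfolding under_neg_eis_phi[OF assms(1,2)] under_pos_eis_psi[OF assms(1,2)]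
  using assms[THEN derived_in_carrier] x by (auto simp: word_simps)

text \<open>Crossing colours are functions of the arc colours, so forgetting them loses nothing; the
  conditions indexed by crossings become the recursion indexed by \<open>k < m\<close>.\<close>

lemma bij_fst_colourings:
  "bij_betw fst (colourings M (eis_psi G x) (eis_phi G x) D \<one> g)
    {F \<in> arc_colourings. F (arc m) = g}"
proof -
  let ?C = "\<lambda>F c. if positive D c then eis_psi G x (F (over_arc D c)) (F (under_out D c))
      else eis_phi G x (F (over_arc D c)) (F (under_out D c))"
  have closed: "F (arc k) \<in> N" "F (arc (Suc k)) \<in> N" "F (over k) \<in> N"
    if "F \<in> arcs D \<rightarrow>\<^sub>E N" "k < m" for F k
    using that arc_in_arcs[of k] arc_in_arcs[of "Suc k"] over_in_arcs[of k]
    by (auto simp del: kth_arc.simps)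
  have cond: "(if sign k then C = eis_psi G x (F (over k)) (F (arc (Suc k))) \<and>
        F (arc k) = under_pos M (eis_psi G x (F (over k)) (F (arc (Suc k)))) (F (over k)) (F (arc (Suc k)))
      else C = eis_phi G x (F (over k)) (F (arc (Suc k))) \<and>
        F (arc k) = under_neg M (eis_phi G x (F (over k)) (F (arc (Suc k)))) (F (over k)) (F (arc (Suc k))))
    \<longleftrightarrow> C = ?C F (kth_crossing D k) \<and> F (arc (Suc k)) =
      signed_pow (\<not> sign k) x \<otimes> F (arc k) \<otimes> inv (F (over k)) \<otimes> signed_pow (sign k) x \<otimes> F (over k)"
    if "F \<in> arcs D \<rightarrow>\<^sub>E N" "k < m" for F k C
    using under_eq_iff[OF closed(3,2,1)[OF that]]
    by (simp add: under_out signed_pow_def del: kth_arc.simps)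
  have eq: "colourings M (eis_psi G x) (eis_phi G x) D \<one> g =
    {(F, C). F \<in> arc_colourings \<and> F (arc m) = g \<and> C = (\<lambda>c\<in>crossings D. ?C F c)}"
  proof -
    have "(F, C) \<in> colourings M (eis_psi G x) (eis_phi G x) D \<one> g \<longleftrightarrow>
      F \<in> arc_colourings \<and> F (arc m) = g \<and> C = (\<lambda>c\<in>crossings D. ?C F c)" for F C
    proof (cases "F \<in> arcs D \<rightarrow>\<^sub>E N")
      case True
      \<comment> \<open>This serves the converse direction: the forced crossing colours have to be
        admissible values of \<open>C\<close>.\<close>
      have CN: "?C F c \<in> N" if "c \<in> crossings D" for c
        using that closed[OF True] crossings eis_phi_in_derived eis_psi_in_derived
        by (auto simp: under_out simp del: kth_arc.simps)
      define Q where "Q c \<longleftrightarrow>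
        (let a = F (over_arc D c); b = F (under_out D c); z = F (under_in D c) in
          if positive D c
          then C c = eis_psi G x a b \<and> z = under_pos M (eis_psi G x a b) a b
          else C c = eis_phi G x a b \<and> z = under_neg M (eis_phi G x a b) a b)" for c
      have Q: "Q (kth_crossing D k) \<longleftrightarrow> C (kth_crossing D k) = ?C F (kth_crossing D k) \<and>
          F (arc (Suc k)) = signed_pow (\<not> sign k) x \<otimes> F (arc k) \<otimes> inv (F (over k)) \<otimes>
            signed_pow (sign k) x \<otimes> F (over k)" if "k < m" for k
        unfolding Q_def Let_def under_in[OF that] under_out by (rule cond[OF True that, unfolded under_out])
      have "carrier (Hgrp M) = N" "carrier (Egrp M) = N"
        by (simp_all add: id_xmod_def derived_group_simps)
      then have "(F, C) \<in> colourings M (eis_psi G x) (eis_phi G x) D \<one> g \<longleftrightarrow>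
        C \<in> crossings D \<rightarrow>\<^sub>E N \<and> F (arc 0) = \<one> \<and> F (arc m) = g \<and> (\<forall>c\<in>crossings D. Q c)"
        using True by (simp only: colourings_def mem_Collect_eq prod.case Q_def top_arc last_arc) blast
      also have "\<dots> \<longleftrightarrow> C \<in> crossings D \<rightarrow>\<^sub>E N \<and> F (arc 0) = \<one> \<and> F (arc m) = g \<and>
        (\<forall>k<m. C (kth_crossing D k) = ?C F (kth_crossing D k) \<and> F (arc (Suc k)) =
          signed_pow (\<not> sign k) x \<otimes> F (arc k) \<otimes> inv (F (over k)) \<otimes> signed_pow (sign k) x \<otimes> F (over k))"
        using Q by (simp only: crossings ball_simps lessThan_iff Ball_def imp_conjL cong: imp_cong) blast
      also have "\<dots> \<longleftrightarrow> F \<in> arc_colourings \<and> F (arc m) = g \<and>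
          C \<in> crossings D \<rightarrow>\<^sub>E N \<and> (\<forall>c\<in>crossings D. C c = ?C F c)"
        unfolding arc_colourings_def crossings
        by (simp only: mem_Collect_eq ball_simps lessThan_iff Ball_def) (use True in blast)
      also have "\<dots> \<longleftrightarrow> F \<in> arc_colourings \<and> F (arc m) = g \<and> C = (\<lambda>c\<in>crossings D. ?C F c)"
        using CN by (auto simp: PiE_iff intro!: extensionalityI[of C "crossings D"])
      finally show ?thesis .
    qed (auto simp: colourings_def arc_colourings_def id_xmod_def derived_group_simps)
    then show ?thesis by auto
  qed
  show ?thesis unfolding eq by (rule bij_betw_imageI) (auto simp: inj_on_def image_iff)
qed

text \<open>The label of a morphism with source \<open>\<one>\<close> equals its target, so the
  colours of the two ends determine the morphism.\<close>

lemma evaluation_colouring: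
  assumes FC: "FC \<in> colourings M (eis_psi G x) (eis_phi G x) D \<one> g"
  shows "evaluation M D FC = (\<one>, g)"
proof -
  interpret C: id_xmod_category "derived_group G"
    by (simp add: id_xmod_category_def group_derived_group)
  have F: "fst FC \<in> arcs D \<rightarrow> carrier (derived_group G)"
    and C: "snd FC \<in> crossings D \<rightarrow> carrier (derived_group G)"
    and ends: "fst FC (top_arc D) = \<one>" "fst FC (bot_arc D) = g"
    using FC by (auto simp: colourings_def)
  have "crossing_compatible (derived_group G) D FC c" if c: "c \<in> crossings D" for c
  proof (rule C.crossing_compatible_colouring)
    obtain k where k: "k < m" "c = kth_crossing D k" using c crossings by auto
    show "snd FC c \<in> carrier (derived_group G)" using C c by blast
    show "fst FC (over_arc D c) \<in> carrier (derived_group G)"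
      "fst FC (under_out D c) \<in> carrier (derived_group G)"
      using F arc_in_arcs[of "Suc k"] over_in_arcs[of k] k by (auto simp: under_out simp del: kth_arc.simps)
    show "fst FC (under_in D c) = (if positive D c
      then under_pos M (snd FC c) (fst FC (over_arc D c)) (fst FC (under_out D c))
      else under_neg M (snd FC c) (fst FC (over_arc D c)) (fst FC (under_out D c)))"
      using FC c by (fastforce simp: colourings_def Let_def split: if_splits)
  qed
  note ev = C.evaluation[OF D F this]
  have "snd (evaluation M D FC) \<in> carrier (derived_group G)" using ev(1) by auto
  then have "snd (evaluation M D FC) \<in> carrier G"
    by (intro derived_in_carrier) (simp add: derived_group_simps)
  then show ?thesis
    using ev(2,3) ends by (intro prod_eqI) (simp_all add: tgt_def derived_group_simps)
qed

text \<open>All colourings contribute the same morphism, so only their number matters; the two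
  bijections identify it with the number of homomorphisms.\<close>

lemma state_sum_eq:
  assumes "finite (carrier G)"
  shows "state_sum M (eis_psi G x) (eis_phi G x) D \<one> g =
    Poly_Mapping.single (\<one>, g) (eisermann_coeff G x D g)"
proof -
  have "state_sum M (eis_psi G x) (eis_phi G x) D \<one> g =
      Poly_Mapping.single (\<one>, g) (card (colourings M (eis_psi G x) (eis_phi G x) D \<one> g))"
    unfolding state_sum_def sum_single_const[symmetric]
    by (rule sum.cong) (simp_all add: evaluation_colouring)
  then show ?thesis
    using bij_betw_same_card[OF bij_fst_colourings] bij_betw_same_card[OF bij_conjugate_colouring]
    by (simp add: eisermann_coeff_eq[OF assms])
qed

end

theorem theorem4p11:
  fixes G :: "'a monoid" and x :: 'a
  assumes "group G" and "finite (carrier G)" and "x \<in> carrier G"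
  shows "(\<forall>g\<in>derived G (carrier G). \<forall>h\<in>derived G (carrier G).
            eis_phi G x g h \<in> derived G (carrier G) \<and>
            eis_psi G x g h \<in> derived G (carrier G) \<and>
            eis_phi G x g h =
              h \<otimes>\<^bsub>G\<^esub> inv\<^bsub>G\<^esub> x \<otimes>\<^bsub>G\<^esub> g \<otimes>\<^bsub>G\<^esub> inv\<^bsub>G\<^esub> h \<otimes>\<^bsub>G\<^esub> x \<otimes>\<^bsub>G\<^esub> inv\<^bsub>G\<^esub> g)
       \<and> crossed_module (id_xmod (derived_group G))
       \<and> unframed_Reidemeister_pair (id_xmod (derived_group G)) (eis_psi G x) (eis_phi G x)
       \<and> (\<forall>D. string_knot_diagram D \<longrightarrow>
            (\<forall>g\<in>derived G (carrier G).
               \<exists>m. Hom (id_xmod (derived_group G)) \<one>\<^bsub>G\<^esub> g = {m} \<and>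
                   state_sum (id_xmod (derived_group G)) (eis_psi G x) (eis_phi G x) D \<one>\<^bsub>G\<^esub> g =
                     Poly_Mapping.single m (eisermann_coeff G x D g)))"
proof -
  interpret eisermann G x
    using assms by (simp add: eisermann_def eisermann_axioms_def)
  interpret C: id_xmod_category "derived_group G"
    by (simp add: id_xmod_category_def group_derived_group)
  have state_sum: "state_sum C.M (eis_psi G x) (eis_phi G x) D \<one>\<^bsub>G\<^esub> g =
      Poly_Mapping.single (\<one>\<^bsub>G\<^esub>, g) (eisermann_coeff G x D g)"
    if D: "string_knot_diagram D" for D g
  proof -
    obtain m where m: "num_arcs D = Suc m" "bij_betw (kth_arc D) {..m} (arcs D)"
      "kth_arc D m = bot_arc D" "crossings D = kth_crossing D ` {..<m}"
      "\<And>k. k < m \<Longrightarrow> under_in D (kth_crossing D k) = kth_arc D k"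
      using string_knot_arcs[OF D] by blast
    interpret string_knot G x D m
      by unfold_locales (use D m in \<open>auto simp: string_knot_diagram_def\<close>)
    show ?thesis by (rule state_sum_eq[OF assms(2)])
  qed
  have Hom: "Hom C.M \<one>\<^bsub>G\<^esub> g = {(\<one>\<^bsub>G\<^esub>, g)}" if "g \<in> derived G (carrier G)" for g
    using C.Hom_one[of g] that by (simp add: derived_group_simps)
  show ?thesis
    using Hom state_sum
    by (intro conjI ballI allI impI unframed_eis crossed_module_id_xmod[OF group_derived_group]
        eis_phi_in_derived eis_psi_in_derived eis_phi_eq derived_in_carrier) blast+
qed

end
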